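(* Let $\alpha_L,\alpha_R,\mu_L,\mu_R,\gamma_{RL},\gamma_{LR}>0$ and consider on the simplex $\Sigma=\{(L,R)\in\mathbb{R}^2: L\ge 0,\ R\ge 0,\ L+R\le 1\}$ the system \[ \dot L=\alpha_L L C-\mu_L L+\gamma_{RL} R C,\qquad \dot R=\alpha_R R C-\mu_R R+\gamma_{LR} L C,\qquad C=1-L-R. \] Let \[K=\begin{pmatrix}\alpha_L&\gamma_{RL}\\ \gamma_{LR}&\alpha_R\end{pmatrix},\qquad M=\begin{pmatrix}\mu_L&0\\0&\mu_R\end{pmatrix},\] and let $\lambda_{\mathrm{PF}}>0$ be the Perron root (spectral radius) of the positive matrix $M^{-1}K$. Then: (1) If $\lambda_{\mathrm{PF}}\le 1$, the equilibrium $E_0=(0,0)$ is globally asymptotically stable on $\Sigma$. (2) If $\lambda_{\mathrm{PF}}>1$, the system has a unique interior equilibrium $E_1=(L^*,R^* )$ (i.e. an equilibrium with $L^*>0$, $R^*>0$, $L^*+R^*<1$), and $E_1$ is globally asymptotically stable on $\Sigma\setminus\{E_0\}$.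
   Context: Here $L$, $R$, $C$ are the left-radical, right-radical and centrist shares of a normalised electorate; $C=1-L-R$ throughout. *)

theory Defs
  imports "HOL-Analysis.Analysis" "Jordan_Normal_Form.Spectral_Radius"
begin

definition rad_field :: "real \<Rightarrow> real \<Rightarrow> real \<Rightarrow> real \<Rightarrow> real \<Rightarrow> real \<Rightarrow> real \<times> real \<Rightarrow> real \<times> real" where
  "rad_field aL aR muL muR gRL gLR p =
     (let L = fst p; R = snd p; C = 1 - L - R in
       (aL * L * C - muL * L + gRL * R * C, aR * R * C - muR * R + gLR * L * C))"

definition rad_simplex :: "(real \<times> real) set" where
  "rad_simplex = {(L, R). L \<ge> 0 \<and> R \<ge> 0 \<and> L + R \<le> 1}"

definition is_solution :: "(real \<times> real \<Rightarrow> real \<times> real) \<Rightarrow> (real \<Rightarrow> real \<times> real) \<Rightarrow> bool" where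
  "is_solution f x \<longleftrightarrow> (\<forall>t\<ge>0. (x has_vector_derivative f (x t)) (at t within {0..}))"

definition GAS_on :: "(real \<times> real \<Rightarrow> real \<times> real) \<Rightarrow> (real \<times> real) set \<Rightarrow> real \<times> real \<Rightarrow> bool" where
  "GAS_on f S e \<longleftrightarrow> e \<in> S \<and> f e = 0 \<and>
     (\<forall>\<epsilon>>0. \<exists>\<delta>>0. \<forall>x. is_solution f x \<and> x 0 \<in> S \<and> dist (x 0) e < \<delta> \<longrightarrow>
         (\<forall>t\<ge>0. dist (x t) e < \<epsilon>)) \<and>
     (\<forall>x. is_solution f x \<and> x 0 \<in> S \<longrightarrow> (x \<longlongrightarrow> e) at_top)"

definition K_mat :: "real \<Rightarrow> real \<Rightarrow> real \<Rightarrow> real \<Rightarrow> real mat" where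
  "K_mat aL aR gRL gLR = mat_of_rows_list 2 [[aL, gRL], [gLR, aR]]"

definition M_mat :: "real \<Rightarrow> real \<Rightarrow> real mat" where
  "M_mat muL muR = mat_of_rows_list 2 [[muL, 0], [0, muR]]"

definition M_inv_mat :: "real \<Rightarrow> real \<Rightarrow> real mat" where
  "M_inv_mat muL muR = mat_of_rows_list 2 [[1 / muL, 0], [0, 1 / muR]]"

definition perron_root :: "real \<Rightarrow> real \<Rightarrow> real \<Rightarrow> real \<Rightarrow> real \<Rightarrow> real \<Rightarrow> real" where
  "perron_root aL aR muL muR gRL gLR =
     spectral_radius (map_mat complex_of_real (M_inv_mat muL muR * K_mat aL aR gRL gLR))"

definition interior_equilibrium :: "(real \<times> real \<Rightarrow> real \<times> real) \<Rightarrow> real \<times> real \<Rightarrow> bool" where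
  "interior_equilibrium f e \<longleftrightarrow> f e = 0 \<and> fst e > 0 \<and> snd e > 0 \<and> fst e + snd e < 1"

end

(*
  Let (v, w) be the left Perron vector of M^-1 K. Then W = (v / muL) L + (w / muR) R satisfies
  W' = (lam C - 1) (v L + w R). For lam <= 1 this makes W a strict Lyapunov function at the origin.

  For lam > 1 the right Perron vector gives an interior equilibrium (l, r), at which C = c = 1 / lam.
  Put z = ln (L / l) - ln (R / r) and d = muL - muR. Then z' = - C F(z) - d (1 - C / c) with F
  increasing and F(0) = 0. If d is nonzero, p = (muL ln (R / r) - muR ln (L / l)) / d satisfies
  p' = C G(z) / d with G increasing and G(0) = 0: in the coordinates (z, p) the system has Lienard
  form, which has a Lyapunov function Gamma(z) + d^2 Theta(p) with Gamma' = G. The natural choice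
  Theta'(p) = 1 / (1 - (l + r) e^p) - 1 / c, the value of 1 / C - 1 / c at z = 0, becomes singular,
  but trajectories end up in a region C >= c0, where 1 - (l + r) e^p can be replaced by its maximum
  with c0. If d = 0, then z' = - C F(z) and a large multiple of e^z - 1 - z added to
  R / r - 1 - ln (R / r) works. The first function is not strict, so convergence uses Barbalat's lemma.
  Uniqueness of the equilibrium is a consequence of its global attractivity.
*)
theory Submission
  imports Defs "HOL-Real_Asymp.Real_Asymp"
begin

section \<open>Differential inequalities on the half line\<close>

text \<open>\<open>GAS_on\<close> speaks about every solution on the half line, so invariance of the
  simplex and persistence have to be derived along an arbitrary solution. For lam > 1 the Lyapunov
  functions contain logarithms and are controlled only where L, R > 0 and C \<ge> c0. Taking c0
  below c puts a neighbourhood of E_1 into this region, which gives stability; taking it also below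
  the eventual lower bound of C makes every trajectory with nonzero start enter the region for good,
  which gives attraction. For d nonzero the rate of Gamma(z) + d^2 Theta(p) is - C F G - d C G (1 /
  C - 1 / c - Theta'(p)); the weight d^2 is what lets the two coupling terms share the factor d C G.
  At fixed p both L and R increase with z / d, so 1 / C minus its value at z = 0 has the sign of z /
  d, as does d G. Hence the second product only helps, and - C F G bounds the rate by a negative
  multiple of z^2. This does not see p, so the limit of C has to be extracted afterwards from the
  equation of z.\<close>

lemma has_real_derivative_half_line:
  assumes "(f has_real_derivative D) (at t within {0..})" "0 < (t::real)"
  shows "(f has_real_derivative D) (at t)"
proof -
  have "at t within {0..} = at t"
    using assms(2) by (intro at_within_interior) (simp add: interior_real_atLeast)
  then show ?thesis using assms(1) by simp
qed

text \<open>Derivatives of solutions are taken within {0..}, hence are one-sided at 0. The mean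
  value theorem needs two-sided derivatives only at interior points, and these are positive, so a =
  0 is admissible.\<close>

lemma half_line_mvt:
  fixes f f' :: "real \<Rightarrow> real"
  assumes "0 \<le> a" "a < b"
    and der: "\<And>t. a \<le> t \<Longrightarrow> t \<le> b \<Longrightarrow> (f has_real_derivative f' t) (at t within {0..})"
  obtains \<xi> where "a < \<xi>" "\<xi> < b" "f b - f a = f' \<xi> * (b - a)"
proof -
  have cont: "continuous_on {a..b} f"
  proof (intro continuous_on_eq_continuous_within[THEN iffD2] ballI)
    fix t assume "t \<in> {a..b}"
    then have "(f has_real_derivative f' t) (at t within {a..b})"
      using der[of t] assms(1) by (auto intro: DERIV_subset)
    then show "continuous (at t within {a..b}) f"
      by (rule DERIV_continuous)
  qed
  have "(f has_derivative (\<lambda>h. f' t * h)) (at t)" if "a < t" "t < b" for t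
    using has_real_derivative_half_line[OF der[of t]] that assms(1)
    by (auto simp: has_field_derivative_def)
  from mvt[OF \<open>a < b\<close> cont this] that show ?thesis by blast
qed

lemma half_line_derivative_le:
  fixes f f' :: "real \<Rightarrow> real"
  assumes "0 \<le> a" "a \<le> b"
    and "\<And>t. a \<le> t \<Longrightarrow> t \<le> b \<Longrightarrow> (f has_real_derivative f' t) (at t within {0..})"
    and "\<And>t. a < t \<Longrightarrow> t < b \<Longrightarrow> f' t \<le> k"
  shows "f b \<le> f a + k * (b - a)"
proof (cases "a = b")
  case False
  then have "a < b" using assms(2) by simp
  then obtain \<xi> where "a < \<xi>" "\<xi> < b" "f b - f a = f' \<xi> * (b - a)"
    using half_line_mvt[OF assms(1) _ assms(3)] by metis
  moreover have "f' \<xi> * (b - a) \<le> k * (b - a)"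
    using assms(4) calculation \<open>a < b\<close> by (intro mult_right_mono) auto
  ultimately show ?thesis by linarith
qed simp

lemma half_line_derivative_ge:
  fixes f f' :: "real \<Rightarrow> real"
  assumes "0 \<le> a" "a \<le> b"
    and "\<And>t. a \<le> t \<Longrightarrow> t \<le> b \<Longrightarrow> (f has_real_derivative f' t) (at t within {0..})"
    and "\<And>t. a < t \<Longrightarrow> t < b \<Longrightarrow> k \<le> f' t"
  shows "f a + k * (b - a) \<le> f b"
  using half_line_derivative_le[of a b "\<lambda>t. - f t" "\<lambda>t. - f' t" "- k"] assms
  by (force intro!: DERIV_minus)

lemma nonincreasing_convergent_at_top:
  fixes V :: "real \<Rightarrow> real"
  assumes mono: "\<And>s t. T \<le> s \<Longrightarrow> s \<le> t \<Longrightarrow> V t \<le> V s"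
    and bound: "\<And>t. T \<le> t \<Longrightarrow> m \<le> V t"
  obtains v where "(V \<longlongrightarrow> v) at_top"
proof -
  define v where "v = Inf (V ` {T..})"
  have bdd: "bdd_below (V ` {T..})"
    using bound by (intro bdd_belowI2[of _ m]) auto
  have "(V \<longlongrightarrow> v) at_top"
  proof (rule order_tendstoI)
    fix a assume "a < v"
    have "v \<le> V t" if "T \<le> t" for t
      unfolding v_def using that bdd by (intro cInf_lower) auto
    then show "\<forall>\<^sub>F t in at_top. a < V t"
      using \<open>a < v\<close> by (intro eventually_at_top_linorderI[of T]) force
  next
    fix a assume "v < a"
    then obtain s where "T \<le> s" "V s < a"
      unfolding v_def using cInf_lessD[of "V ` {T..}" a] by auto
    then show "\<forall>\<^sub>F t in at_top. V t < a"
      using mono by (intro eventually_at_top_linorderI[of s]) force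
  qed
  then show ?thesis using that by blast
qed

text \<open>A form of Barbalat's lemma: each time the dissipation rate exceeds \<open>\<epsilon>\<close>, the lower bound
  on its derivative keeps it above \<open>\<epsilon>/2\<close> long enough for \<open>V\<close> to drop by a fixed amount, which a
  convergent \<open>V\<close> cannot afford.\<close>
lemma barbalat_eventually_less:
  fixes V V' \<phi> \<phi>' e :: "real \<Rightarrow> real"
  assumes "0 \<le> T"
    and dV: "\<And>t. T \<le> t \<Longrightarrow> (V has_real_derivative V' t) (at t within {0..})"
    and le: "\<And>t. T \<le> t \<Longrightarrow> V' t \<le> e t - \<phi> t"
    and e: "(e \<longlongrightarrow> 0) at_top"
    and V: "(V \<longlongrightarrow> v) at_top"
    and d\<phi>: "\<And>t. T \<le> t \<Longrightarrow> (\<phi> has_real_derivative \<phi>' t) (at t within {0..})"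
    and K: "\<And>t. T \<le> t \<Longrightarrow> - K \<le> \<phi>' t"
    and "0 < \<epsilon>"
  shows "\<forall>\<^sub>F t in at_top. \<phi> t < \<epsilon>"
proof -
  define k where "k = max K 1"
  \<comment> \<open>In time h a function whose slope is at least - k falls by at most k * h =
    \<epsilon> / 2.\<close>
  define h where "h = \<epsilon> / (2 * k)"
  have k: "0 < k" "\<And>t. T \<le> t \<Longrightarrow> - k \<le> \<phi>' t"
    unfolding k_def using K by force+
  have h: "0 < h" unfolding h_def using \<open>0 < \<epsilon>\<close> k(1) by simp
  have "\<forall>\<^sub>F t in at_top. e t < \<epsilon> / 4"
    using e \<open>0 < \<epsilon>\<close> by (intro order_tendstoD(2)) auto
  then obtain T1 where T1: "\<And>t. T1 \<le> t \<Longrightarrow> e t < \<epsilon> / 4"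
    unfolding eventually_at_top_linorder by blast
  \<comment> \<open>Over a window of length h the rate of V is at most \<epsilon> / 4 - \<epsilon> /
    2, so V drops by at least \<epsilon> * h / 4. Two values within \<epsilon> * h / 16 of the limit
    differ by less than half of that.\<close>
  have "0 < \<epsilon> * h / 16" using \<open>0 < \<epsilon>\<close> h by simp
  then have "\<forall>\<^sub>F t in at_top. \<bar>V t - v\<bar> < \<epsilon> * h / 16"
    using V unfolding tendsto_iff dist_real_def by blast
  then obtain T2 where T2: "\<And>t. T2 \<le> t \<Longrightarrow> \<bar>V t - v\<bar> < \<epsilon> * h / 16"
    unfolding eventually_at_top_linorder by blast
  define T3 where "T3 = max T (max T1 T2)"
  have "\<phi> t < \<epsilon>" if t: "T3 \<le> t" for t
  proof (rule ccontr)
    assume "\<not> \<phi> t < \<epsilon>"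
    then have large: "\<epsilon> \<le> \<phi> t" by simp
    have T: "T \<le> t" "T1 \<le> t" "T2 \<le> t" using t unfolding T3_def by auto
    have low: "\<epsilon> / 2 \<le> \<phi> s" if s: "t \<le> s" "s \<le> t + h" for s
    proof -
      have "\<phi> t + (- k) * (s - t) \<le> \<phi> s"
        using s T \<open>0 \<le> T\<close> k(2) by (intro half_line_derivative_ge[of t s \<phi> \<phi>'] d\<phi>) auto
      moreover have "k * (s - t) \<le> k * h"
        using s k(1) by (intro mult_left_mono) auto
      moreover have "k * h = \<epsilon> / 2" unfolding h_def using k(1) by simp
      ultimately show ?thesis using large by simp
    qed
    have "V (t + h) \<le> V t + (- (\<epsilon> / 4)) * (t + h - t)"
    proof (rule half_line_derivative_le[where f' = V'])
      fix s assume s: "t < s" "s < t + h"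
      then have "e s < \<epsilon> / 4" "\<epsilon> / 2 \<le> \<phi> s" "V' s \<le> e s - \<phi> s"
        using T1[of s] low[of s] le[of s] T by auto
      then show "V' s \<le> - (\<epsilon> / 4)" by simp
    qed (use T \<open>0 \<le> T\<close> h dV in auto)
    moreover have "\<bar>V (t + h) - v\<bar> < \<epsilon> * h / 16" "\<bar>V t - v\<bar> < \<epsilon> * h / 16"
      using T2 T h by auto
    moreover have "0 < \<epsilon> * h" using \<open>0 < \<epsilon>\<close> h by simp
    ultimately show False by (simp add: algebra_simps abs_less_iff)
  qed
  then show ?thesis by (rule eventually_at_top_linorderI)
qed

lemma tendsto_zero_of_square_eventually_less:
  fixes f :: "real \<Rightarrow> real"
  assumes "0 < k" and ev: "\<And>\<epsilon>. 0 < \<epsilon> \<Longrightarrow> \<forall>\<^sub>F t in F. k * (f t)\<^sup>2 < \<epsilon>"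
  shows "(f \<longlongrightarrow> 0) F"
  unfolding tendsto_iff dist_real_def
proof (intro allI impI)
  fix \<epsilon> :: real assume "0 < \<epsilon>"
  then have "0 < k * \<epsilon>\<^sup>2" using \<open>0 < k\<close> by simp
  from ev[OF this] show "\<forall>\<^sub>F t in F. \<bar>f t - 0\<bar> < \<epsilon>"
  proof eventually_elim
    case (elim t)
    then have "(f t)\<^sup>2 < \<epsilon>\<^sup>2" using \<open>0 < k\<close> by simp
    then show ?case using \<open>0 < \<epsilon>\<close> abs_le_square_iff[of \<epsilon> "f t"] by auto
  qed
qed

text \<open>First-exit argument: the minimum of V over a small sphere exceeds V e, and a trajectory
  that starts below this minimum would have to raise V in order to reach the sphere. The decrease is
  demanded only while the trajectory stays in the ball, so V may be a merely local Lyapunov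
  function.\<close>

lemma strict_lyapunov_stable:
  fixes V :: "'a::euclidean_space \<Rightarrow> real" and sol :: "(real \<Rightarrow> 'a) \<Rightarrow> bool"
  assumes "0 < \<rho>"
    and V: "continuous_on (cball e \<rho>) V"
    and pos: "\<And>p. p \<in> cball e \<rho> \<Longrightarrow> p \<noteq> e \<Longrightarrow> V e < V p"
    and cont: "\<And>x. sol x \<Longrightarrow> continuous_on {0..} x"
    and dec: "\<And>x T. sol x \<Longrightarrow> 0 \<le> T \<Longrightarrow> (\<And>t. 0 \<le> t \<Longrightarrow> t \<le> T \<Longrightarrow> x t \<in> cball e \<rho>) \<Longrightarrow> V (x T) \<le> V (x 0)"
    and "0 < \<epsilon>"
  shows "\<exists>\<delta>>0. \<forall>x. sol x \<and> dist (x 0) e < \<delta> \<longrightarrow> (\<forall>t\<ge>0. dist (x t) e < \<epsilon>)"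
proof -
  define r where "r = min \<epsilon> \<rho>"
  have r: "0 < r" "r \<le> \<rho>" "r \<le> \<epsilon>" unfolding r_def using \<open>0 < \<epsilon>\<close> \<open>0 < \<rho>\<close> by auto
  have "continuous_on (sphere e r) V"
    using V r(2) by (rule_tac continuous_on_subset) auto
  moreover have "compact (sphere e r)" "sphere e r \<noteq> {}" using r(1) by auto
  ultimately obtain p where p: "p \<in> sphere e r" "\<And>q. q \<in> sphere e r \<Longrightarrow> V p \<le> V q"
    using continuous_attains_inf by metis
  have "p \<noteq> e" using p(1) r(1) by auto
  then have "V e < V p" using pos p(1) r(2) by auto
  have "isCont V e"
    using V \<open>0 < \<rho>\<close> by (intro continuous_on_interior[OF V]) auto
  then have "\<forall>\<^sub>F q in at e. V q < V p"
    unfolding isCont_def using \<open>V e < V p\<close> by (rule order_tendstoD(2))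
  then obtain d where d: "0 < d" "\<And>q. dist q e < d \<Longrightarrow> q \<noteq> e \<Longrightarrow> V q < V p"
    unfolding eventually_at by auto
  have "dist (x t) e < \<epsilon>" if x: "sol x" "dist (x 0) e < min d r" and "0 \<le> t" for x t
  proof (rule ccontr)
    assume "\<not> dist (x t) e < \<epsilon>"
    then have far: "r \<le> dist (x t) e" using r by simp
    have cd: "continuous_on {0..t} (\<lambda>s. dist (x s) e)"
      by (intro continuous_intros continuous_on_subset[OF cont[OF x(1)]]) auto
    \<comment> \<open>The least element of this closed set of times is the first exit time; by the
      intermediate value theorem the distance there is exactly r.\<close>
    define A where "A = {s \<in> {0..t}. r \<le> dist (x s) e}"
    have "closed A"
      using continuous_closed_preimage[OF cd closed_atLeastAtMost closed_atLeast[of r]]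
      unfolding A_def by (simp add: vimage_def Collect_conj_eq[symmetric] Int_def)
    moreover have "A \<subseteq> {0..t}" unfolding A_def by auto
    then have "bounded A" using bounded_closed_interval bounded_subset by blast
    ultimately have "compact A" by (simp add: compact_eq_bounded_closed)
    moreover have "A \<noteq> {}" unfolding A_def using far \<open>0 \<le> t\<close> by auto
    ultimately obtain T where T: "T \<in> A" "\<And>s. s \<in> A \<Longrightarrow> T \<le> s"
      using compact_attains_inf by metis
    have T0: "0 \<le> T" "T \<le> t" "r \<le> dist (x T) e" using T(1) unfolding A_def by auto
    have before: "dist (x s) e < r" if "0 \<le> s" "s < T" for s
      using T(2)[of s] that T0 unfolding A_def by fastforce
    have "dist (x T) e \<le> r"
    proof (rule ccontr)
      assume gt: "\<not> dist (x T) e \<le> r"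
      have "\<exists>s\<ge>0. s \<le> T \<and> dist (x s) e = r"
        using x(2) T0 gt continuous_on_subset[OF cd, of "{0..T}"]
        by (intro IVT') auto
      then obtain s where s: "0 \<le> s" "s \<le> T" "dist (x s) e = r" by blast
      then show False using before[of s] gt by (cases "s = T") auto
    qed
    then have eqr: "dist (x T) e = r" using T0 by simp
    have "V (x T) \<le> V (x 0)"
    proof (rule dec[OF x(1) T0(1)])
      fix s assume "0 \<le> s" "s \<le> T"
      then show "x s \<in> cball e \<rho>"
        using before[of s] eqr r(2) by (cases "s = T") (auto simp: dist_commute)
    qed
    moreover have "V (x 0) < V p" using d(2)[of "x 0"] x(2) \<open>V e < V p\<close> by (cases "x 0 = e") auto
    moreover have "V p \<le> V (x T)" using p(2)[of "x T"] eqr by (simp add: dist_commute)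
    ultimately show False by simp
  qed
  then show ?thesis using d(1) r(1) by (intro exI[of _ "min d r"]) auto
qed

text \<open>Squaring makes the negative part differentiable at 0 as well, so that it can serve in a
  Gronwall argument as a penalty for leaving the simplex.\<close>

lemma has_real_derivative_neg_part_square:
  fixes x :: real
  shows "((\<lambda>x. (max 0 (- x))\<^sup>2) has_real_derivative - 2 * max 0 (- x)) (at x)"
proof -
  consider "x < 0" | "x > 0" | "x = 0" by linarith
  then show ?thesis
  proof cases
    case 1
    have "((\<lambda>x. x\<^sup>2) has_real_derivative - 2 * max 0 (- x)) (at x)"
      using 1 by (auto intro!: derivative_eq_intros)
    then show ?thesis
      by (rule has_field_derivative_transform_within_open[of _ _ _ "{..<0}"]) (use 1 in auto)
  next
    case 2
    have "((\<lambda>x. 0) has_real_derivative - 2 * max 0 (- x)) (at x)"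
      using 2 by (auto intro!: derivative_eq_intros)
    then show ?thesis
      by (rule has_field_derivative_transform_within_open[of _ _ _ "{0<..}"]) (use 2 in auto)
  next
    case 3
    have "((\<lambda>h::real. (max 0 (- h))\<^sup>2 / h) \<longlongrightarrow> 0) (at 0)"
    proof (rule Lim_null_comparison)
      have "norm ((max 0 (- h))\<^sup>2 / h) \<le> \<bar>h\<bar>" for h :: real
        by (cases "h < 0") (auto simp: power2_eq_square)
      then show "\<forall>\<^sub>F h in at 0. norm ((max 0 (- h))\<^sup>2 / h) \<le> \<bar>h\<bar>" for h :: real
        by simp
      show "((\<lambda>h::real. \<bar>h\<bar>) \<longlongrightarrow> 0) (at 0)" by (intro tendsto_eq_intros) auto
    qed
    then show ?thesis using 3 by (simp add: DERIV_def)
  qed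
qed

section \<open>The radicalisation system\<close>

locale radical_system =
  fixes aL aR mL mR gRL gLR :: real
  assumes pos: "0 < aL" "0 < aR" "0 < mL" "0 < mR" "0 < gRL" "0 < gLR"

locale radical_trajectory = radical_system +
  fixes L R :: "real \<Rightarrow> real"
  assumes L_deriv: "0 \<le> t \<Longrightarrow> (L has_real_derivative
      aL * L t * (1 - L t - R t) - mL * L t + gRL * R t * (1 - L t - R t)) (at t within {0..})"
    and R_deriv: "0 \<le> t \<Longrightarrow> (R has_real_derivative
      aR * R t * (1 - L t - R t) - mR * R t + gLR * L t * (1 - L t - R t)) (at t within {0..})"
begin

definition C :: "real \<Rightarrow> real" where "C t = 1 - L t - R t"

lemma L_derivative: "0 \<le> t \<Longrightarrow> (L has_real_derivative
    aL * L t * C t - mL * L t + gRL * R t * C t) (at t within {0..})"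
  and R_derivative: "0 \<le> t \<Longrightarrow> (R has_real_derivative
    aR * R t * C t - mR * R t + gLR * L t * C t) (at t within {0..})"
  using L_deriv R_deriv unfolding C_def by auto

lemma C_derivative:
  assumes "0 \<le> t"
  shows "(C has_real_derivative
    mL * L t + mR * R t - C t * ((aL + gLR) * L t + (aR + gRL) * R t)) (at t within {0..})"
proof -
  have "((\<lambda>t. 1 - L t - R t) has_real_derivative
    mL * L t + mR * R t - C t * ((aL + gLR) * L t + (aR + gRL) * R t)) (at t within {0..})"
    by (rule derivative_eq_intros L_derivative[OF assms] R_derivative[OF assms] refl)+
      (simp add: algebra_simps)
  then show ?thesis by (simp add: C_def[abs_def])
qed

lemma swapped_trajectory: "radical_trajectory aR aL mR mL gLR gRL R L"
proof unfold_locales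
  fix t :: real assume "0 \<le> t"
  have eq: "1 - R t - L t = 1 - L t - R t" by simp
  show "(R has_real_derivative
      aR * R t * (1 - R t - L t) - mR * R t + gLR * L t * (1 - R t - L t)) (at t within {0..})"
    "(L has_real_derivative
      aL * L t * (1 - R t - L t) - mL * L t + gRL * R t * (1 - R t - L t)) (at t within {0..})"
    unfolding eq using \<open>0 \<le> t\<close> L_deriv R_deriv by auto
qed (use pos in auto)

end

section \<open>Forward invariance of the simplex\<close>

context radical_system
begin

text \<open>The Gronwall estimate behind the forward invariance of the simplex: \<open>N\<close> measures how far
  \<open>(l, r, c)\<close> is from having nonnegative entries.\<close>
lemma neg_part_square_rate_le:
  fixes l r c B :: real
  assumes B: "\<bar>l\<bar> \<le> B" "\<bar>r\<bar> \<le> B" "\<bar>c\<bar> \<le> B"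
  defines "N \<equiv> (max 0 (- l))\<^sup>2 + (max 0 (- r))\<^sup>2 + (max 0 (- c))\<^sup>2"
  shows "- 2 * max 0 (- l) * (aL * l * c - mL * l + gRL * r * c)
       - 2 * max 0 (- r) * (aR * r * c - mR * r + gLR * l * c)
       - 2 * max 0 (- c) * (mL * l + mR * r - c * ((aL + gLR) * l + (aR + gRL) * r))
     \<le> (4 * (aL + aR) * B + 6 * (gRL + gLR) * B + 2 * (mL + mR)) * N"
proof -
  define p where "p = max 0 (- l)"
  define q where "q = max 0 (- r)"
  define s where "s = max 0 (- c)"
  have nonneg: "0 \<le> p" "0 \<le> q" "0 \<le> s" "0 \<le> B" unfolding p_def q_def s_def using B by auto
  have sq: "p * l = - p\<^sup>2" "q * r = - q\<^sup>2" "s * c = - s\<^sup>2"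
    unfolding p_def q_def s_def by (auto simp: max_def power2_eq_square)
  have N: "N = p\<^sup>2 + q\<^sup>2 + s\<^sup>2" unfolding N_def p_def q_def s_def ..
  have below: "- l \<le> p" "- r \<le> q" unfolding p_def q_def by auto
  have N_ge: "p\<^sup>2 \<le> N" "q\<^sup>2 \<le> N" "s\<^sup>2 \<le> N" unfolding N by auto
  have "x * y \<le> N / 2" if "x\<^sup>2 + y\<^sup>2 \<le> N" for x y
    using sum_squares_bound[of x y] that by simp
  then have mixed: "p * q \<le> N / 2" "p * s \<le> N / 2" "q * s \<le> N / 2"
    by (simp_all add: N)
  \<comment> \<open>If x and c have opposite signs, one factor is at most B and the other is minus
    its own negative part; if they have equal signs, the left side is not positive.\<close>
  have product: "- (x * c) \<le> B * (max 0 (- x) + s)" if "\<bar>x\<bar> \<le> B" for x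
  proof -
    consider "0 \<le> x \<and> 0 \<le> c" | "x < 0" "0 \<le> c" | "0 \<le> x" "c < 0" | "x < 0" "c < 0" by linarith
    then show ?thesis
    proof cases
      case 1 then show ?thesis using nonneg by (smt (verit) mult_nonneg_nonneg)
    next
      case 2
      then have "(- x) * c \<le> (- x) * B" using B by (intro mult_left_mono) auto
      moreover have "0 \<le> B * s" using nonneg by simp
      moreover have "B * (max 0 (- x) + s) = (- x) * B + B * s" "(- x) * c = - (x * c)"
        using 2 by (auto simp: algebra_simps)
      ultimately show ?thesis by linarith
    next
      case 3
      then have "x * (- c) \<le> B * (- c)" using that by (intro mult_right_mono) auto
      then show ?thesis using 3 by (simp add: s_def)
    next
      case 4
      then have "0 \<le> x * c" by (simp add: mult_nonpos_nonpos)
      moreover have "0 \<le> B * (max 0 (- x) + s)" using nonneg by (intro mult_nonneg_nonneg) auto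
      ultimately show ?thesis by linarith
    qed
  qed
  have growth: "2 * a * p\<^sup>2 * c \<le> 2 * a * B * N" if "0 < a" "p\<^sup>2 \<le> N" for a p
  proof -
    have "c * p\<^sup>2 \<le> B * N" using B that nonneg by (intro mult_mono) auto
    then show ?thesis using that by (simp add: algebra_simps)
  qed
  have t1: "- 2 * p * (aL * l * c - mL * l + gRL * r * c) \<le> 2 * aL * B * N + 2 * gRL * B * N"
  proof -
    have "p * (- (r * c)) \<le> p * (B * (q + s))"
      using product[OF B(2)] nonneg unfolding q_def by (intro mult_left_mono) auto
    also have "\<dots> = B * (p * q + p * s)" by (simp add: algebra_simps)
    also have "\<dots> \<le> B * N" using mixed nonneg by (intro mult_left_mono) linarith+
    finally have "2 * gRL * (p * (- (r * c))) \<le> 2 * gRL * (B * N)"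
      using pos by (intro mult_left_mono) auto
    moreover have "2 * aL * p\<^sup>2 * c \<le> 2 * aL * B * N" using growth pos N_ge by blast
    moreover have "- 2 * p * (aL * l * c - mL * l + gRL * r * c) =
        - 2 * aL * c * (p * l) + 2 * mL * (p * l) + 2 * gRL * (p * (- (r * c)))"
      by (simp add: algebra_simps)
    moreover have "0 \<le> mL * p\<^sup>2" using pos by simp
    ultimately show ?thesis unfolding sq by (simp add: algebra_simps)
  qed
  have t2: "- 2 * q * (aR * r * c - mR * r + gLR * l * c) \<le> 2 * aR * B * N + 2 * gLR * B * N"
  proof -
    have "q * (- (l * c)) \<le> q * (B * (p + s))"
      using product[OF B(1)] nonneg unfolding p_def by (intro mult_left_mono) auto
    also have "\<dots> = B * (p * q + q * s)" by (simp add: algebra_simps)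
    also have "\<dots> \<le> B * N" using mixed nonneg by (intro mult_left_mono) linarith+
    finally have "2 * gLR * (q * (- (l * c))) \<le> 2 * gLR * (B * N)"
      using pos by (intro mult_left_mono) auto
    moreover have "2 * aR * q\<^sup>2 * c \<le> 2 * aR * B * N" using growth pos N_ge by blast
    moreover have "- 2 * q * (aR * r * c - mR * r + gLR * l * c) =
        - 2 * aR * c * (q * r) + 2 * mR * (q * r) + 2 * gLR * (q * (- (l * c)))"
      by (simp add: algebra_simps)
    moreover have "0 \<le> mR * q\<^sup>2" using pos by simp
    ultimately show ?thesis unfolding sq by (simp add: algebra_simps)
  qed
  have t3: "- 2 * s * (mL * l + mR * r - c * ((aL + gLR) * l + (aR + gRL) * r))
      \<le> (mL + mR) * N + 2 * (aL + gLR + aR + gRL) * B * N"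
  proof -
    have "s * (- l) \<le> s * p" "s * (- r) \<le> s * q"
      using below nonneg by (intro mult_left_mono; simp)+
    then have "s * (- l) \<le> N / 2" "s * (- r) \<le> N / 2"
      using mixed by (auto simp: mult.commute)
    then have "2 * mL * (s * (- l)) \<le> 2 * mL * (N / 2)" "2 * mR * (s * (- r)) \<le> 2 * mR * (N / 2)"
      using pos by (intro mult_left_mono; simp)+
    moreover have "s\<^sup>2 * (- x) \<le> B * N" if "\<bar>x\<bar> \<le> B" for x
      using mult_mono[of "- x" B "s\<^sup>2" N] that nonneg N_ge by (auto simp: mult.commute)
    then have "2 * (aL + gLR) * (s\<^sup>2 * (- l)) \<le> 2 * (aL + gLR) * (B * N)"
      "2 * (aR + gRL) * (s\<^sup>2 * (- r)) \<le> 2 * (aR + gRL) * (B * N)"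
      using B pos by (intro mult_left_mono; simp)+
    moreover have "- 2 * s * (mL * l + mR * r - c * ((aL + gLR) * l + (aR + gRL) * r)) =
       2 * mL * (s * (- l)) + 2 * mR * (s * (- r))
        + 2 * (s * c) * ((aL + gLR) * l + (aR + gRL) * r)"
      by (simp add: algebra_simps)
    ultimately show ?thesis unfolding sq by (simp add: algebra_simps)
  qed
  have "0 \<le> B * N" "0 \<le> N" using nonneg N by auto
  then have "0 \<le> gRL * B * N" "0 \<le> gLR * B * N" "0 \<le> mL * N" "0 \<le> mR * N"
    using pos by (auto simp: mult.assoc)
  with t1 t2 t3 show ?thesis
    unfolding p_def[symmetric] q_def[symmetric] s_def[symmetric] by (simp add: algebra_simps)
qed

end

context radical_trajectory
begin

lemma continuous_on_L: "continuous_on {0..} L"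
  and continuous_on_R: "continuous_on {0..} R"
  using L_derivative R_derivative DERIV_continuous
  unfolding continuous_on_eq_continuous_within by (metis atLeast_iff)+

text \<open>The three signs depend on each other: on the edge L = 0, for instance, L' is nonnegative
  only as long as R C is. A single Gronwall estimate therefore treats them together: N starts at 0
  and satisfies N' \<le> K N. The bound B inside K comes from compactness of [0, T], so no prior
  bound on the solution enters.\<close>

lemma simplex_invariant:
  assumes init: "0 \<le> L 0" "0 \<le> R 0" "L 0 + R 0 \<le> 1" and "0 \<le> T"
  shows "0 \<le> L T \<and> 0 \<le> R T \<and> 0 \<le> C T"
proof -
  have "bounded (f ` {0..T})" if "continuous_on {0..} f" for f :: "real \<Rightarrow> real"
    by (intro compact_imp_bounded compact_continuous_image continuous_on_subset[OF that]) auto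
  then obtain B1 B2 where B12: "\<forall>x\<in>L ` {0..T}. norm x \<le> B1" "\<forall>x\<in>R ` {0..T}. norm x \<le> B2"
    using continuous_on_L continuous_on_R unfolding bounded_iff by meson
  define B where "B = 1 + B1 + B2"
  have B: "\<bar>L t\<bar> \<le> B \<and> \<bar>R t\<bar> \<le> B \<and> \<bar>C t\<bar> \<le> B" if "0 \<le> t" "t \<le> T" for t
  proof -
    have "\<bar>L t\<bar> \<le> B1" "\<bar>R t\<bar> \<le> B2" using B12 that by auto
    then show ?thesis unfolding B_def C_def by auto
  qed
  define K where "K = 4 * (aL + aR) * B + 6 * (gRL + gLR) * B + 2 * (mL + mR)"
  define N where "N t = (max 0 (- L t))\<^sup>2 + (max 0 (- R t))\<^sup>2 + (max 0 (- C t))\<^sup>2" for t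
  define N' where "N' t = - 2 * max 0 (- L t) * (aL * L t * C t - mL * L t + gRL * R t * C t)
       - 2 * max 0 (- R t) * (aR * R t * C t - mR * R t + gLR * L t * C t)
       - 2 * max 0 (- C t) * (mL * L t + mR * R t - C t * ((aL + gLR) * L t + (aR + gRL) * R t))" for t
  have N_deriv: "(N has_real_derivative N' t) (at t within {0..})" if "0 \<le> t" for t
    unfolding N_def[abs_def] N'_def
    by (rule DERIV_cong[OF DERIV_add[OF DERIV_add
          [OF DERIV_chain2[OF has_real_derivative_neg_part_square L_derivative[OF that]]
            DERIV_chain2[OF has_real_derivative_neg_part_square R_derivative[OF that]]]
          DERIV_chain2[OF has_real_derivative_neg_part_square C_derivative[OF that]]]])
      (simp add: algebra_simps)
  have N'_le: "N' t \<le> K * N t" if "0 \<le> t" "t \<le> T" for t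
    using neg_part_square_rate_le[of "L t" B "R t" "C t"] B[OF that]
    unfolding N'_def N_def K_def by auto
  have "N T * exp (- K * T) \<le> N 0 * exp (- K * 0) + 0 * (T - 0)"
  proof (rule half_line_derivative_le[where f = "\<lambda>t. N t * exp (- K * t)"
        and f' = "\<lambda>t. (N' t - K * N t) * exp (- K * t)"])
    fix t assume "0 \<le> t" "t \<le> T"
    then show "((\<lambda>t. N t * exp (- K * t)) has_real_derivative (N' t - K * N t) * exp (- K * t))
        (at t within {0..})"
      by (auto intro!: derivative_eq_intros N_deriv simp: algebra_simps)
  next
    fix t assume "0 < t" "t < T"
    then show "(N' t - K * N t) * exp (- K * t) \<le> 0"
      using N'_le[of t] by (simp add: mult_nonpos_nonneg)
  qed (use \<open>0 \<le> T\<close> in auto)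
  moreover have "N 0 = 0" using init unfolding N_def C_def by simp
  ultimately have "N T \<le> 0" by (simp add: mult_le_0_iff)
  then have "(max 0 (- L T))\<^sup>2 = 0" "(max 0 (- R T))\<^sup>2 = 0" "(max 0 (- C T))\<^sup>2 = 0"
    using zero_le_power2[of "max 0 (- L T)"] zero_le_power2[of "max 0 (- R T)"]
      zero_le_power2[of "max 0 (- C T)"] unfolding N_def by linarith+
  then show ?thesis by (auto simp: max_def split: if_splits)
qed

end

locale simplex_trajectory = radical_trajectory +
  assumes init: "0 \<le> L 0" "0 \<le> R 0" "L 0 + R 0 \<le> 1"
begin

lemma swapped_simplex_trajectory: "simplex_trajectory aR aL mR mL gLR gRL R L"
  using swapped_trajectory init
  by (simp add: simplex_trajectory_def simplex_trajectory_axioms_def add.commute)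

lemma in_simplex:
  assumes "0 \<le> t"
  shows "0 \<le> L t" "0 \<le> R t" "0 \<le> C t" "L t \<le> 1" "R t \<le> 1" "C t \<le> 1"
  using simplex_invariant[OF init assms] unfolding C_def by auto

text \<open>Input for Barbalat's lemma, which asks for control of the derivative of the dissipation
  rate. The shares and their products lie in [0, 1], so every term is bounded by its coefficient,
  and C' = - L' - R'.\<close>

lemma derivative_bounds:
  obtains K where "\<And>t. 0 \<le> t \<Longrightarrow> \<bar>aL * L t * C t - mL * L t + gRL * R t * C t\<bar> \<le> K"
    "\<And>t. 0 \<le> t \<Longrightarrow> \<bar>aR * R t * C t - mR * R t + gLR * L t * C t\<bar> \<le> K"
    "\<And>t. 0 \<le> t \<Longrightarrow> \<bar>mL * L t + mR * R t - C t * ((aL + gLR) * L t + (aR + gRL) * R t)\<bar> \<le> K"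
    "0 \<le> K"
proof -
  define a where "a t = aL * L t * C t - mL * L t + gRL * R t * C t" for t
  define b where "b t = aR * R t * C t - mR * R t + gLR * L t * C t" for t
  have le: "x * y \<le> 1" if "0 \<le> x" "x \<le> 1" "0 \<le> y" "y \<le> 1" for x y :: real
    using mult_le_one that by blast
  have sc: "0 \<le> g * x" "g * x \<le> g" if "0 < g" "0 \<le> x" "x \<le> 1" for g x :: real
    using that by (auto intro: mult_left_le)
  have "\<bar>a t\<bar> \<le> aL + mL + gRL \<and> \<bar>b t\<bar> \<le> aR + mR + gLR" if "0 \<le> t" for t
  proof -
    note s = in_simplex[OF that]
    have u: "0 \<le> L t * C t" "L t * C t \<le> 1" "0 \<le> R t * C t" "R t * C t \<le> 1"
      using s le by auto
    show ?thesis
      using sc[OF pos(1) u(1,2)] sc[OF pos(2) u(3,4)] sc[OF pos(3) s(1,4)] sc[OF pos(4) s(2,5)]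
        sc[OF pos(5) u(3,4)] sc[OF pos(6) u(1,2)]
      unfolding a_def b_def mult.assoc abs_le_iff by linarith
  qed
  moreover have "mL * L t + mR * R t - C t * ((aL + gLR) * L t + (aR + gRL) * R t) = - a t - b t" for t
    unfolding a_def b_def by (simp add: algebra_simps)
  ultimately show ?thesis
    using pos by (intro that[of "aL + mL + gRL + (aR + mR + gLR)"])
      (force simp: a_def[symmetric] b_def[symmetric] abs_le_iff)+
qed

end

section \<open>Persistence: lower bounds for C, L and R\<close>

context simplex_trajectory
begin

text \<open>Since L + R = 1 - C, exits return at least m (1 - C) to the centre while recruitment
  removes at most k C. The left side is the solution of y' = m - (k + m) y with y(0) = 0, and c1 is
  its limit.\<close>

lemma C_lower_bound:
  fixes k m c1 :: real
  defines "k \<equiv> aL + aR + gRL + gLR" and "m \<equiv> min mL mR"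
  defines "c1 \<equiv> m / (k + m)"
  assumes "0 \<le> t"
  shows "c1 * (1 - exp (- (k + m) * t)) \<le> C t"
proof -
  define C' where "C' t = mL * L t + mR * R t - C t * ((aL + gLR) * L t + (aR + gRL) * R t)" for t
  have km: "0 < k + m" "0 < m" unfolding k_def m_def using pos by auto
  then have c1: "0 < c1" "(k + m) * c1 = m" unfolding c1_def by auto
  have rate: "0 \<le> C' s + (k + m) * (C s - c1)" if "0 \<le> s" for s
  proof -
    note x = in_simplex[OF that]
    have "(aL + gLR) * L s \<le> aL + gLR" "(aR + gRL) * R s \<le> aR + gRL"
      using x pos by (auto intro: mult_left_le)
    then have "C s * ((aL + gLR) * L s + (aR + gRL) * R s) \<le> C s * k"
      using x unfolding k_def by (intro mult_left_mono) auto
    moreover have "m * L s \<le> mL * L s" "m * R s \<le> mR * R s"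
      using x unfolding m_def by (auto intro: mult_right_mono)
    moreover have "m * C s = m - m * L s - m * R s" unfolding C_def by (simp add: algebra_simps)
    ultimately show ?thesis using c1(2) unfolding C'_def by (simp add: algebra_simps)
  qed
  have "(C 0 - c1) * exp ((k + m) * 0) + 0 * (t - 0) \<le> (C t - c1) * exp ((k + m) * t)"
  proof (rule half_line_derivative_ge[where
        f' = "\<lambda>s. (C' s + (k + m) * (C s - c1)) * exp ((k + m) * s)"])
    fix s assume "0 \<le> s" "s \<le> t"
    then show "((\<lambda>s. (C s - c1) * exp ((k + m) * s)) has_real_derivative
        (C' s + (k + m) * (C s - c1)) * exp ((k + m) * s)) (at s within {0..})"
      unfolding C'_def by (auto intro!: derivative_eq_intros C_derivative simp: algebra_simps)
  qed (use rate \<open>0 \<le> t\<close> in auto)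
  then have "- c1 \<le> (C t - c1) * exp ((k + m) * t)" using in_simplex(3)[of 0] by simp
  then have "- c1 * exp (- (k + m) * t) \<le> (C t - c1) * exp ((k + m) * t) * exp (- (k + m) * t)"
    by (intro mult_right_mono) auto
  also have "\<dots> = C t - c1" by (simp add: mult.assoc algebra_simps flip: exp_add)
  finally show ?thesis by (simp add: algebra_simps)
qed

lemma C_pos:
  assumes "0 < t"
  shows "0 < C t"
proof -
  define k where "k = aL + aR + gRL + gLR + min mL mR"
  have "0 < k" unfolding k_def using pos by (auto simp: min_def)
  then have "0 < min mL mR / k * (1 - exp (- k * t))"
    using assms pos by (intro mult_pos_pos) auto
  also have "\<dots> \<le> C t" using C_lower_bound[of t] assms unfolding k_def by simp
  finally show ?thesis .
qed

lemma C_eventually_bounded_below: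
  assumes "0 < c0" "c0 < min mL mR / (aL + aR + gRL + gLR + min mL mR)"
  shows "\<exists>T>0. \<forall>t\<ge>T. c0 \<le> C t"
proof -
  define k where "k = aL + aR + gRL + gLR + min mL mR"
  define c1 where "c1 = min mL mR / k"
  have "0 < k" unfolding k_def using pos by (auto simp: min_def)
  then have "((\<lambda>t. c1 * (1 - exp (- k * t))) \<longlongrightarrow> c1) at_top"
    by real_asymp
  then have "\<forall>\<^sub>F t in at_top. c0 < c1 * (1 - exp (- k * t))"
    using assms unfolding c1_def k_def by (intro order_tendstoD(1)) auto
  then obtain T where T: "\<And>t. T \<le> t \<Longrightarrow> c0 < c1 * (1 - exp (- k * t))"
    unfolding eventually_at_top_linorder by blast
  have "c0 \<le> C t" if "max T 1 \<le> t" for t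
    using T[of t] C_lower_bound[of t] that unfolding c1_def k_def by auto
  then show ?thesis by (intro exI[of _ "max T 1"]) auto
qed

text \<open>The integrating factor absorbs the exit term and leaves only recruitment, which is
  nonnegative on the simplex.\<close>

lemma L_scaled_derivative:
  assumes "0 \<le> t"
  shows "((\<lambda>t. L t * exp (mL * t)) has_real_derivative
    (aL * L t * C t + gRL * R t * C t) * exp (mL * t)) (at t within {0..})"
  by (auto intro!: derivative_eq_intros L_derivative assms simp: algebra_simps)

lemma L_pos_of_initial:
  assumes "0 < L 0" "0 \<le> t"
  shows "0 < L t"
proof -
  have "L 0 * exp (mL * 0) + 0 * (t - 0) \<le> L t * exp (mL * t)"
  proof (rule half_line_derivative_ge[where
        f' = "\<lambda>t. (aL * L t * C t + gRL * R t * C t) * exp (mL * t)"])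
    fix s assume "0 < s" "s < t"
    then show "0 \<le> (aL * L s * C s + gRL * R s * C s) * exp (mL * s)"
      using in_simplex[of s] pos by simp
  qed (use assms L_scaled_derivative in auto)
  then have "0 < L t * exp (mL * t)" using assms(1) by simp
  then show ?thesis by (simp add: zero_less_mult_iff)
qed

text \<open>Even from L = 0 the term gRL R C produces left radicals at once, because C is positive
  at every positive time.\<close>

lemma L_pos_of_R_pos:
  assumes "\<And>s. 0 \<le> s \<Longrightarrow> 0 < R s" "0 < t"
  shows "0 < L t"
proof -
  obtain \<xi> where \<xi>: "0 < \<xi>" "\<xi> < t"
    "L t * exp (mL * t) - L 0 * exp (mL * 0)
      = (aL * L \<xi> * C \<xi> + gRL * R \<xi> * C \<xi>) * exp (mL * \<xi>) * (t - 0)"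
    using half_line_mvt[OF order_refl assms(2) L_scaled_derivative] by blast
  have "0 < (aL * L \<xi> * C \<xi> + gRL * R \<xi> * C \<xi>) * exp (mL * \<xi>) * (t - 0)"
    using \<xi>(1) assms C_pos[of \<xi>] in_simplex[of \<xi>] pos
    by (intro mult_pos_pos add_nonneg_pos) auto
  then have "0 < L t * exp (mL * t)" using \<xi>(3) in_simplex(1)[of 0] by simp
  then show ?thesis by (simp add: zero_less_mult_iff)
qed

text \<open>A share that starts positive stays positive and feeds the other one, so starts on the
  edges of the simplex other than the origin cause no exception.\<close>

lemma interior_after_start:
  assumes "L 0 \<noteq> 0 \<or> R 0 \<noteq> 0" "0 < t"
  shows "0 < L t \<and> 0 < R t"
proof -
  interpret swap: simplex_trajectory aR aL mR mL gLR gRL R L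
    by (rule swapped_simplex_trajectory)
  from assms(1) init consider "0 < L 0" | "0 < R 0" by fastforce
  then show ?thesis
  proof cases
    case 1
    then have "0 < L s" if "0 \<le> s" for s using L_pos_of_initial that by blast
    then show ?thesis using swap.L_pos_of_R_pos assms(2) by simp
  next
    case 2
    then have "0 < R s" if "0 \<le> s" for s using swap.L_pos_of_initial that by blast
    then show ?thesis using L_pos_of_R_pos assms(2) by simp
  qed
qed

end

section \<open>The case lam \<le> 1: global stability of the origin\<close>

locale subcritical = radical_system +
  fixes v w lam :: real
  assumes v_pos: "0 < v" "0 < w"
    and left_eigenvector: "v * aL / mL + w * gLR / mR = lam * v" "v * gRL / mL + w * aR / mR = lam * w"
    and lam_le: "lam \<le> 1"

locale subcritical_trajectory = simplex_trajectory + subcritical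
begin

definition W :: "real \<Rightarrow> real" where "W t = v / mL * L t + w / mR * R t"

lemma W_derivative:
  assumes "0 \<le> t"
  shows "(W has_real_derivative (lam * C t - 1) * (v * L t + w * R t)) (at t within {0..})"
proof -
  have "((\<lambda>t. v / mL * L t + w / mR * R t) has_real_derivative
      v / mL * (aL * L t * C t - mL * L t + gRL * R t * C t)
      + w / mR * (aR * R t * C t - mR * R t + gLR * L t * C t)) (at t within {0..})"
    by (intro DERIV_add DERIV_cmult L_derivative R_derivative assms)
  moreover have "v / mL * (aL * L t * C t - mL * L t + gRL * R t * C t)
      + w / mR * (aR * R t * C t - mR * R t + gLR * L t * C t)
      = C t * L t * (v * aL / mL + w * gLR / mR) + C t * R t * (v * gRL / mL + w * aR / mR)
        - (v * L t + w * R t)"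
    using pos by (simp add: field_simps)
  then have "v / mL * (aL * L t * C t - mL * L t + gRL * R t * C t)
      + w / mR * (aR * R t * C t - mR * R t + gLR * L t * C t)
      = (lam * C t - 1) * (v * L t + w * R t)"
    unfolding left_eigenvector by (simp add: algebra_simps)
  ultimately show ?thesis unfolding W_def[abs_def] by simp
qed

text \<open>Here lam C - 1 \<le> C - 1 = - (L + R). At the threshold lam = 1 linear decay is lost,
  but this quadratic dissipation survives, so one argument covers all lam \<le> 1.\<close>

lemma W_rate_le:
  assumes "0 \<le> t"
  shows "(lam * C t - 1) * (v * L t + w * R t) \<le> - (min v w * (L t + R t)\<^sup>2)"
proof -
  note x = in_simplex[OF assms]
  have "lam * C t \<le> 1 * C t" using x lam_le by (intro mult_right_mono) auto
  then have "(lam * C t - 1) * (v * L t + w * R t) \<le> (- (L t + R t)) * (v * L t + w * R t)"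
    using x v_pos by (intro mult_right_mono) (auto simp: C_def)
  moreover have "min v w * L t \<le> v * L t" "min v w * R t \<le> w * R t"
    using x by (auto intro: mult_right_mono)
  then have "(L t + R t) * (min v w * (L t + R t)) \<le> (L t + R t) * (v * L t + w * R t)"
    using x by (intro mult_left_mono) (auto simp: algebra_simps)
  ultimately show ?thesis by (simp add: power2_eq_square algebra_simps)
qed

lemma W_nonincreasing:
  assumes "0 \<le> s" "s \<le> t"
  shows "W t \<le> W s"
proof -
  have "W t \<le> W s + 0 * (t - s)"
  proof (rule half_line_derivative_le[where f' = "\<lambda>t. (lam * C t - 1) * (v * L t + w * R t)"])
    fix r assume "s < r" "r < t"
    moreover have "0 \<le> min v w * (L r + R r)\<^sup>2" using v_pos by simp
    ultimately show "(lam * C r - 1) * (v * L r + w * R r) \<le> 0" 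
      using W_rate_le[of r] assms by linarith
  qed (use assms W_derivative in auto)
  then show ?thesis by simp
qed

lemma total_tendsto_zero: "((\<lambda>t. L t + R t) \<longlongrightarrow> 0) at_top"
proof (rule tendsto_zero_of_square_eventually_less)
  show "0 < min v w" using v_pos by simp
  fix \<epsilon> :: real assume "0 < \<epsilon>"
  define L' where "L' t = aL * L t * C t - mL * L t + gRL * R t * C t" for t
  define R' where "R' t = aR * R t * C t - mR * R t + gLR * L t * C t" for t
  obtain K where K: "\<And>t. 0 \<le> t \<Longrightarrow> \<bar>L' t\<bar> \<le> K" "\<And>t. 0 \<le> t \<Longrightarrow> \<bar>R' t\<bar> \<le> K" "0 \<le> K"
    using derivative_bounds unfolding L'_def R'_def by metis
  obtain w0 where w0: "(W \<longlongrightarrow> w0) at_top"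
  proof (rule nonincreasing_convergent_at_top[of 0 W 0])
    show "0 \<le> W t" if "0 \<le> t" for t
      using in_simplex[OF that] v_pos pos unfolding W_def by simp
  qed (use W_nonincreasing in auto)
  show "\<forall>\<^sub>F t in at_top. min v w * (L t + R t)\<^sup>2 < \<epsilon>"
  proof (rule barbalat_eventually_less[where T = 0 and V = W and e = "\<lambda>_. 0"
        and K = "min v w * (4 * (K + K))"])
    fix t :: real assume t: "0 \<le> t"
    show "((\<lambda>t. min v w * (L t + R t)\<^sup>2) has_real_derivative
       min v w * (2 * ((L t + R t) * (L' t + R' t)))) (at t within {0..})"
      unfolding L'_def R'_def
      by (rule DERIV_cmult) (auto intro!: derivative_eq_intros L_derivative R_derivative t)
    have "\<bar>(L t + R t) * (L' t + R' t)\<bar> \<le> 2 * (K + K)"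
      unfolding abs_mult using in_simplex[OF t] K(1,2)[OF t] K(3) by (intro mult_mono) auto
    then have "- (4 * (K + K)) \<le> 2 * ((L t + R t) * (L' t + R' t))" by (simp add: abs_le_iff)
    then have "min v w * (- (4 * (K + K))) \<le> min v w * (2 * ((L t + R t) * (L' t + R' t)))"
      using v_pos by (intro mult_left_mono) auto
    then show "- (min v w * (4 * (K + K))) \<le> min v w * (2 * ((L t + R t) * (L' t + R' t)))" by simp
  qed (use W_derivative W_rate_le w0 \<open>0 < \<epsilon>\<close> in auto)
qed

end

lemma (in simplex_trajectory) dist_origin_le: "0 \<le> t \<Longrightarrow> dist (L t, R t) (0, 0) \<le> L t + R t"
  using in_simplex[of t] by (simp add: dist_Pair_Pair sqrt_sum_squares_le_sum)

lemma (in radical_system) trajectory_of_solution: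
  assumes "is_solution (rad_field aL aR mL mR gRL gLR) x"
  shows "radical_trajectory aL aR mL mR gRL gLR (\<lambda>t. fst (x t)) (\<lambda>t. snd (x t))"
proof unfold_locales
  fix t :: real assume "0 \<le> t"
  then have d: "(x has_vector_derivative rad_field aL aR mL mR gRL gLR (x t)) (at t within {0..})"
    using assms unfolding is_solution_def by blast
  from bounded_linear.has_vector_derivative[OF bounded_linear_fst d] 
    bounded_linear.has_vector_derivative[OF bounded_linear_snd d]
  show "((\<lambda>t. fst (x t)) has_real_derivative
      aL * fst (x t) * (1 - fst (x t) - snd (x t)) - mL * fst (x t)
      + gRL * snd (x t) * (1 - fst (x t) - snd (x t))) (at t within {0..})"
    "((\<lambda>t. snd (x t)) has_real_derivative
      aR * snd (x t) * (1 - fst (x t) - snd (x t)) - mR * snd (x t)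
      + gLR * fst (x t) * (1 - fst (x t) - snd (x t))) (at t within {0..})"
    by (simp_all add: rad_field_def Let_def has_real_derivative_iff_has_vector_derivative)
qed

lemma (in radical_system) simplex_trajectory_of_solution:
  assumes "is_solution (rad_field aL aR mL mR gRL gLR) x" "x 0 \<in> rad_simplex"
  shows "simplex_trajectory aL aR mL mR gRL gLR (\<lambda>t. fst (x t)) (\<lambda>t. snd (x t))"
  using trajectory_of_solution[OF assms(1)] assms(2)
  by (auto simp: simplex_trajectory_def simplex_trajectory_axioms_def rad_simplex_def)

theorem (in subcritical) origin_GAS: "GAS_on (rad_field aL aR mL mR gRL gLR) rad_simplex (0, 0)"
  unfolding GAS_on_def
proof (intro conjI allI impI)
  let ?f = "rad_field aL aR mL mR gRL gLR"
  show "(0, 0) \<in> rad_simplex" by (simp add: rad_simplex_def)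
  show "?f (0, 0) = 0" by (simp add: rad_field_def zero_prod_def)
  have traj: "subcritical_trajectory aL aR mL mR gRL gLR (\<lambda>t. fst (x t)) (\<lambda>t. snd (x t)) v w lam"
    if "is_solution ?f x" "x 0 \<in> rad_simplex" for x
    using simplex_trajectory_of_solution[OF that] subcritical_axioms
    by (simp add: subcritical_trajectory_def subcritical_def)
  fix \<epsilon> :: real assume "0 < \<epsilon>"
  \<comment> \<open>W lies above a times the distance to the origin and, at time 0, below b times
    that distance; hence the choice \<delta> = \<epsilon> * a / b.\<close>
  define a where "a = min (v / mL) (w / mR)"
  define b where "b = v / mL + w / mR"
  have ab: "0 < a" "0 < b" unfolding a_def b_def using v_pos pos by (auto intro: add_pos_pos)
  show "\<exists>\<delta>>0. \<forall>x. is_solution ?f x \<and> x 0 \<in> rad_simplex \<and> dist (x 0) (0, 0) < \<delta> \<longrightarrow>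
      (\<forall>t\<ge>0. dist (x t) (0, 0) < \<epsilon>)"
  proof (intro exI[of _ "\<epsilon> * a / b"] conjI allI impI)
    show "0 < \<epsilon> * a / b" using ab \<open>0 < \<epsilon>\<close> by simp
    fix x and t :: real
    assume x: "is_solution ?f x \<and> x 0 \<in> rad_simplex \<and> dist (x 0) (0, 0) < \<epsilon> * a / b"
      and "0 \<le> t"
    then interpret subcritical_trajectory aL aR mL mR gRL gLR "\<lambda>t. fst (x t)" "\<lambda>t. snd (x t)" v w lam
      using traj by blast
    have "a * fst (x t) \<le> v / mL * fst (x t)" "a * snd (x t) \<le> w / mR * snd (x t)"
      unfolding a_def using in_simplex[OF \<open>0 \<le> t\<close>] by (intro mult_right_mono; simp)+
    then have "a * (fst (x t) + snd (x t)) \<le> W t" unfolding W_def by (simp add: algebra_simps)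
    moreover have "a * dist (x t) (0, 0) \<le> a * (fst (x t) + snd (x t))"
      using dist_origin_le[OF \<open>0 \<le> t\<close>] ab by (intro mult_left_mono) auto
    moreover have "W t \<le> W 0" using W_nonincreasing \<open>0 \<le> t\<close> by blast
    moreover have "fst (x 0) \<le> dist (x 0) (0, 0)" "snd (x 0) \<le> dist (x 0) (0, 0)"
      using dist_fst_le[of "x 0" "(0, 0)"] dist_snd_le[of "x 0" "(0, 0)"] by (auto simp: dist_real_def)
    then have "v / mL * fst (x 0) \<le> v / mL * dist (x 0) (0, 0)"
        "w / mR * snd (x 0) \<le> w / mR * dist (x 0) (0, 0)"
      using v_pos pos by (intro mult_left_mono; simp)+
    then have "W 0 \<le> b * dist (x 0) (0, 0)"
      unfolding W_def b_def by (simp only: distrib_right)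
    moreover have "b * dist (x 0) (0, 0) < b * (\<epsilon> * a / b)"
      using x ab by (intro mult_strict_left_mono) auto
    ultimately have "a * dist (x t) (0, 0) < b * (\<epsilon> * a / b)" by linarith
    then show "dist (x t) (0, 0) < \<epsilon>" using ab by simp
  qed
next
  fix x assume "is_solution (rad_field aL aR mL mR gRL gLR) x \<and> x 0 \<in> rad_simplex"
  then interpret subcritical_trajectory aL aR mL mR gRL gLR "\<lambda>t. fst (x t)" "\<lambda>t. snd (x t)" v w lam
    using simplex_trajectory_of_solution subcritical_axioms
    by (simp add: subcritical_trajectory_def subcritical_def)
  show "(x \<longlongrightarrow> (0, 0)) at_top"
    unfolding tendsto_dist_iff[of x]
  proof (rule Lim_null_comparison[OF _ total_tendsto_zero])
    show "\<forall>\<^sub>F t in at_top. norm (dist (x t) (0, 0)) \<le> fst (x t) + snd (x t)"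
      using dist_origin_le by (intro eventually_at_top_linorderI[of 0]) simp
  qed
qed

section \<open>The supercritical case\<close>

text \<open>The functions F and G of the overview both have this shape, with coefficients (A, B) and
  (mR * A, mL * B). The first summand stems from conversion into L, the second from conversion into
  R.\<close>

definition bal :: "real \<Rightarrow> real \<Rightarrow> real \<Rightarrow> real" where
  "bal a b z = a * (1 - exp (- z)) + b * (exp z - 1)"

definition bal_pot :: "real \<Rightarrow> real \<Rightarrow> real \<Rightarrow> real" where
  "bal_pot a b z = a * (z + exp (- z) - 1) + b * (exp z - 1 - z)"

lemma bal_pot_derivative: "(bal_pot a b has_real_derivative bal a b z) (at z)"
  unfolding bal_def bal_pot_def[abs_def]
  by (auto intro!: derivative_eq_intros simp: algebra_simps)

lemma bal_zero [simp]: "bal a b 0 = 0"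
  by (simp add: bal_def)

lemma continuous_bal [continuous_intros]: "continuous_on UNIV (bal a b)"
  unfolding bal_def[abs_def] by (intro continuous_intros)

lemma abs_bal_le:
  assumes "0 < a" "0 < b" "\<bar>z\<bar> \<le> Z"
  shows "\<bar>bal a b z\<bar> \<le> (a + b) * exp Z"
proof -
  have e: "exp z \<le> exp Z" "exp (- z) \<le> exp Z" "1 \<le> exp Z" "0 < exp z" "0 < exp (- z)"
    using assms by auto
  have "a * (1 - exp (- z)) \<le> a * exp Z" "a * (exp (- z) - 1) \<le> a * exp Z"
    "b * (1 - exp z) \<le> b * exp Z" "b * (exp z - 1) \<le> b * exp Z"
    using assms(1,2) e by (intro mult_left_mono; linarith)+
  then show ?thesis unfolding bal_def abs_le_iff by (simp add: algebra_simps)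
qed

lemma bal_ge:
  assumes "0 < a" "0 < b" "0 \<le> z"
  shows "min a b * z \<le> bal a b z"
proof -
  have "min a b * z \<le> b * z" using assms by (intro mult_right_mono) auto
  also have "\<dots> \<le> b * (exp z - 1)"
    using assms exp_ge_add_one_self[of z] by (intro mult_left_mono) linarith+
  also have "\<dots> \<le> bal a b z" unfolding bal_def using assms by simp
  finally show ?thesis .
qed

lemma bal_minus: "bal a b (- z) = - bal b a z"
  unfolding bal_def by (simp add: algebra_simps)

lemma bal_sign:
  assumes "0 < a" "0 < b"
  shows "min a b * z\<^sup>2 \<le> z * bal a b z"
proof (cases "0 \<le> z")
  case True
  then show ?thesis
    using mult_left_mono[OF bal_ge[OF assms True] True] by (simp add: power2_eq_square algebra_simps)
next
  case False
  then show ?thesis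
    using mult_left_mono[OF bal_ge[OF assms(2,1), of "- z"], of "- z"] 
    by (simp add: power2_eq_square bal_minus min.commute algebra_simps)
qed

text \<open>Two instances of \<open>bal_sign\<close> multiply to this inequality with an additional
  factor z^2 on both sides, which is then cancelled.\<close>

lemma bal_mult_ge:
  assumes "0 < a" "0 < b" "0 < a'" "0 < b'"
  shows "min a b * min a' b' * z\<^sup>2 \<le> bal a b z * bal a' b' z"
proof (cases "z = 0")
  case False
  have "(min a b * z\<^sup>2) * (min a' b' * z\<^sup>2) \<le> (z * bal a b z) * (z * bal a' b' z)"
  proof (rule mult_mono[OF bal_sign bal_sign])
    have "0 \<le> min a b * z\<^sup>2" using assms by simp
    then show "0 \<le> z * bal a b z" using bal_sign[OF assms(1,2), of z] by linarith
  qed (use assms in auto)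
  then have "z\<^sup>2 * (min a b * min a' b' * z\<^sup>2) \<le> z\<^sup>2 * (bal a b z * bal a' b' z)"
    by (simp add: power2_eq_square mult.commute mult.left_commute)
  then show ?thesis using False by (simp only: mult_le_cancel_left) auto
qed simp

lemma bal_pot_ge:
  assumes "0 < a" "0 < b"
  shows "min a b * z\<^sup>2 / 2 \<le> bal_pot a b z"
proof -
  have key: "min a b * z\<^sup>2 / 2 \<le> bal_pot a b z" if "0 < a" "0 < b" "0 \<le> z" for a b z :: real
  proof -
    have "min a b * (z\<^sup>2 / 2) \<le> b * (z\<^sup>2 / 2)" using that by (intro mult_right_mono) auto
    also have "\<dots> \<le> b * (exp z - 1 - z)"
      using that exp_lower_Taylor_quadratic[of z] by (intro mult_left_mono) auto
    also have "\<dots> \<le> bal_pot a b z"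
      unfolding bal_pot_def using that exp_ge_add_one_self[of "- z"] by simp
    finally show ?thesis by simp
  qed
  \<comment> \<open>Reflection exchanges a and b, so the estimate for nonnegative arguments
    suffices.\<close>
  have "bal_pot a b z = bal_pot b a (- z)" unfolding bal_pot_def by (simp add: algebra_simps)
  then show ?thesis
    using key[OF assms, of z] key[OF assms(2,1), of "- z"] by (cases "0 \<le> z") (auto simp: min.commute)
qed

section \<open>Logarithmic coordinates at the interior equilibrium\<close>

locale supercritical = radical_system +
  fixes l r :: real
  assumes l_pos: "0 < l" and r_pos: "0 < r" and sum_less: "l + r < 1"
    and eq_L: "aL * l * (1 - l - r) - mL * l + gRL * r * (1 - l - r) = 0"
    and eq_R: "aR * r * (1 - l - r) - mR * r + gLR * l * (1 - l - r) = 0"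
begin

definition c :: real where "c = 1 - l - r"
text \<open>A and B are the conversion coefficients once L is measured in units of l and R in units
  of r.\<close>

definition A :: real where "A = gRL * r / l"
definition B :: real where "B = gLR * l / r"
definition d :: real where "d = mL - mR"

lemma c_pos: "0 < c" and A_pos: "0 < A" and B_pos: "0 < B"
  unfolding c_def A_def B_def using l_pos r_pos sum_less pos by auto

text \<open>Eliminating aL, and likewise aR, through the equilibrium equations makes the exit and
  recruitment terms combine into mL * (1 - C / c) and mR * (1 - C / c) in the logarithmic
  derivatives.\<close>

lemma aL_eq: "aL = mL / c - A"
proof -
  have "aL * (l * c) = mL * l - gRL * r * c"
    using eq_L unfolding c_def[symmetric] by (simp add: algebra_simps)
  then have "aL = (mL * l - gRL * r * c) / (l * c)"
    using l_pos c_pos by (simp add: nonzero_eq_divide_eq)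
  also have "\<dots> = mL / c - A"
    unfolding A_def using l_pos c_pos by (simp add: diff_divide_distrib)
  finally show ?thesis .
qed

lemma aR_eq: "aR = mR / c - B"
proof -
  have "aR * (r * c) = mR * r - gLR * l * c"
    using eq_R unfolding c_def[symmetric] by (simp add: algebra_simps)
  then have "aR = (mR * r - gLR * l * c) / (r * c)"
    using r_pos c_pos by (simp add: nonzero_eq_divide_eq)
  also have "\<dots> = mR / c - B"
    unfolding B_def using r_pos c_pos by (simp add: diff_divide_distrib)
  finally show ?thesis .
qed

definition logratio :: "real \<times> real \<Rightarrow> real" where
  "logratio p = ln (fst p / l) - ln (snd p / r)"

lemma exp_logratio:
  assumes "0 < x" "0 < y"
  shows "exp (logratio (x, y)) = (x / l) / (y / r)" "exp (- logratio (x, y)) = (y / r) / (x / l)"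
  using assms l_pos r_pos unfolding logratio_def by (simp_all add: exp_diff exp_minus)

lemma logratio_equilibrium [simp]: "logratio (l, r) = 0"
  using l_pos r_pos by (simp add: logratio_def)

lemma stable_of_lyapunov:
  fixes V :: "real \<times> real \<Rightarrow> real"
  assumes V_cont: "continuous_on ({0<..} \<times> {0<..}) V"
    and V_pos: "\<And>x y. 0 < x \<Longrightarrow> 0 < y \<Longrightarrow> (x, y) \<noteq> (l, r) \<Longrightarrow> V (l, r) < V (x, y)"
    and c0: "c0 < c"
    and V_dec: "\<And>L R t. radical_trajectory aL aR mL mR gRL gLR L R \<Longrightarrow> 0 \<le> t \<Longrightarrow> 0 < L t \<Longrightarrow>
      0 < R t \<Longrightarrow> c0 \<le> 1 - L t - R t \<Longrightarrow>
      \<exists>D\<le>0. ((\<lambda>t. V (L t, R t)) has_real_derivative D) (at t within {0..})"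
    and "0 < \<epsilon>"
  shows "\<exists>\<delta>>0. \<forall>x. is_solution (rad_field aL aR mL mR gRL gLR) x \<and> x 0 \<in> S \<and> dist (x 0) (l, r) < \<delta>
    \<longrightarrow> (\<forall>t\<ge>0. dist (x t) (l, r) < \<epsilon>)"
proof -
  let ?sol = "is_solution (rad_field aL aR mL mR gRL gLR)"
  \<comment> \<open>The ball must lie in the open quadrant, and on it 1 - x - y differs from c by at
    most 2 * \<rho> \<le> c - c0.\<close>
  define \<rho> where "\<rho> = min (min (l / 2) (r / 2)) ((c - c0) / 2)"
  have "0 < \<rho>" unfolding \<rho>_def using l_pos r_pos c0 by simp
  moreover have "\<rho> \<le> l / 2" "\<rho> \<le> r / 2" "\<rho> \<le> (c - c0) / 2"
    unfolding \<rho>_def by (rule min.coboundedI1 min.coboundedI2 order_refl)+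
  ultimately have \<rho>: "0 < \<rho>" "\<rho> < l" "\<rho> < r" "\<rho> \<le> (c - c0) / 2"
    using l_pos r_pos by auto
  have near: "0 < fst p \<and> 0 < snd p \<and> c0 \<le> 1 - fst p - snd p" if "p \<in> cball (l, r) \<rho>" for p
  proof -
    have "\<bar>l - fst p\<bar> \<le> \<rho>" "\<bar>r - snd p\<bar> \<le> \<rho>"
      using that dist_fst_le[of "(l, r)" p] dist_snd_le[of "(l, r)" p]
      by (auto simp: dist_real_def)
    then show ?thesis using \<rho> c_def by (simp add: abs_le_iff)
  qed
  have "\<exists>\<delta>>0. \<forall>x. ?sol x \<and> dist (x 0) (l, r) < \<delta> \<longrightarrow> (\<forall>t\<ge>0. dist (x t) (l, r) < \<epsilon>)"
  proof (rule strict_lyapunov_stable[OF \<rho>(1)])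
    show "continuous_on (cball (l, r) \<rho>) V"
      by (rule continuous_on_subset[OF V_cont]) (use near in \<open>auto simp: mem_Times_iff\<close>)
    show "V (l, r) < V p" if "p \<in> cball (l, r) \<rho>" "p \<noteq> (l, r)" for p
      using near[OF that(1)] V_pos[of "fst p" "snd p"] that(2) by simp
  next
    fix x assume "?sol x"
    then show "continuous_on {0..} x"
      unfolding is_solution_def continuous_on_eq_continuous_within
      using has_vector_derivative_continuous by (metis atLeast_iff)
  next
    fix x and T :: real
    assume x: "?sol x" "0 \<le> T" and stay: "\<And>t. 0 \<le> t \<Longrightarrow> t \<le> T \<Longrightarrow> x t \<in> cball (l, r) \<rho>"
    have "\<forall>t\<in>{0..T}. \<exists>D\<le>0. ((\<lambda>t. V (fst (x t), snd (x t))) has_real_derivative D) (at t within {0..})"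
      using V_dec[OF trajectory_of_solution[OF x(1)]] near stay by simp
    then obtain D where D: "\<And>t. t \<in> {0..T} \<Longrightarrow> D t \<le> 0"
      "\<And>t. t \<in> {0..T} \<Longrightarrow> ((\<lambda>t. V (fst (x t), snd (x t))) has_real_derivative D t) (at t within {0..})"
      by metis
    have "V (fst (x T), snd (x T)) \<le> V (fst (x 0), snd (x 0)) + 0 * (T - 0)"
      using D x(2) by (intro half_line_derivative_le[where f' = D]) auto
    then show "V (x T) \<le> V (x 0)" by simp
  qed (rule \<open>0 < \<epsilon>\<close>)
  then show ?thesis by blast
qed

end

locale supercritical_trajectory = supercritical + radical_trajectory
begin

definition z :: "real \<Rightarrow> real" where "z t = logratio (L t, R t)"

lemma exp_z:
  assumes "0 < L t" "0 < R t"
  shows "exp (z t) = (L t / l) / (R t / r)" "exp (- z t) = (R t / r) / (L t / l)"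
  using exp_logratio[OF assms] unfolding z_def by auto

lemma log_L_derivative:
  assumes "0 \<le> t" "0 < L t" "0 < R t"
  shows "((\<lambda>t. ln (L t / l)) has_real_derivative
    - C t * (A * (1 - exp (- z t))) - mL * (1 - C t / c)) (at t within {0..})"
proof -
  have "((\<lambda>t. ln (L t / l)) has_real_derivative
      1 / (L t / l) * ((aL * L t * C t - mL * L t + gRL * R t * C t) / l)) (at t within {0..})"
    using assms l_pos by (intro DERIV_ln_divide[THEN DERIV_chain2] DERIV_cdivide L_derivative) auto
  moreover have "1 / (L t / l) * ((aL * L t * C t - mL * L t + gRL * R t * C t) / l)
      = aL * C t - mL + gRL * R t / L t * C t"
    using assms l_pos by (simp add: field_simps)
  moreover have "gRL * R t / L t = A * exp (- z t)"
    unfolding exp_z(2)[OF assms(2,3)] A_def using assms l_pos r_pos by (simp add: field_simps)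
  moreover have "aL * C t - mL + A * exp (- z t) * C t
      = - C t * (A * (1 - exp (- z t))) - mL * (1 - C t / c)"
    by (simp add: aL_eq algebra_simps)
  ultimately show ?thesis by (simp only:)
qed

lemma log_R_derivative:
  assumes "0 \<le> t" "0 < L t" "0 < R t"
  shows "((\<lambda>t. ln (R t / r)) has_real_derivative
    C t * (B * (exp (z t) - 1)) - mR * (1 - C t / c)) (at t within {0..})"
proof -
  have "((\<lambda>t. ln (R t / r)) has_real_derivative
      1 / (R t / r) * ((aR * R t * C t - mR * R t + gLR * L t * C t) / r)) (at t within {0..})"
    using assms r_pos by (intro DERIV_ln_divide[THEN DERIV_chain2] DERIV_cdivide R_derivative) auto
  moreover have "1 / (R t / r) * ((aR * R t * C t - mR * R t + gLR * L t * C t) / r)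
      = aR * C t - mR + gLR * L t / R t * C t"
    using assms r_pos by (simp add: field_simps)
  moreover have "gLR * L t / R t = B * exp (z t)"
    unfolding exp_z(1)[OF assms(2,3)] B_def using assms l_pos r_pos by (simp add: field_simps)
  moreover have "aR * C t - mR + B * exp (z t) * C t
      = C t * (B * (exp (z t) - 1)) - mR * (1 - C t / c)"
    by (simp add: aR_eq algebra_simps)
  ultimately show ?thesis by (simp only:)
qed

lemma z_derivative:
  assumes "0 \<le> t" "0 < L t" "0 < R t"
  shows "(z has_real_derivative - C t * bal A B (z t) - d * (1 - C t / c)) (at t within {0..})"
proof -
  have "z = (\<lambda>t. ln (L t / l) - ln (R t / r))" by (auto simp: z_def logratio_def)
  moreover have "- C t * (A * (1 - exp (- z t))) - mL * (1 - C t / c)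
      - (C t * (B * (exp (z t) - 1)) - mR * (1 - C t / c))
      = - C t * bal A B (z t) - d * (1 - C t / c)"
    unfolding bal_def d_def by (simp add: algebra_simps diff_divide_distrib)
  ultimately show ?thesis
    using DERIV_diff[OF log_L_derivative[OF assms] log_R_derivative[OF assms]] by (simp only:)
qed

end

section \<open>Late-time behaviour of persistent trajectories\<close>

locale persistent_trajectory = supercritical_trajectory + simplex_trajectory +
  fixes T c0 :: real
  assumes T_pos: "0 < T" and c0: "0 < c0" "c0 < c"
    and persistent: "T \<le> t \<Longrightarrow> 0 < L t" "T \<le> t \<Longrightarrow> 0 < R t" "T \<le> t \<Longrightarrow> c0 \<le> C t"
begin

lemma z_derivative_late:
  "T \<le> t \<Longrightarrow> (z has_real_derivative - C t * bal A B (z t) - d * (1 - C t / c)) (at t within {0..})"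
  using z_derivative persistent T_pos by simp

lemma z_rate_bounded:
  assumes "\<And>t. T \<le> t \<Longrightarrow> \<bar>z t\<bar> \<le> Z"
  shows "\<exists>K. \<forall>t\<ge>T. \<bar>- C t * bal A B (z t) - d * (1 - C t / c)\<bar> \<le> K"
proof (intro exI allI impI)
  fix t assume t: "T \<le> t"
  then have C: "0 \<le> C t" "C t \<le> 1" using in_simplex T_pos by auto
  have "\<bar>C t * bal A B (z t)\<bar> \<le> 1 * ((A + B) * exp Z)"
    unfolding abs_mult using abs_bal_le[OF A_pos B_pos assms[OF t]] C by (intro mult_mono) auto
  moreover have "\<bar>1 - C t / c\<bar> \<le> 1 + 1 / c"
    using C c_pos by (simp add: abs_le_iff field_simps)
  then have "\<bar>d * (1 - C t / c)\<bar> \<le> \<bar>d\<bar> * (1 + 1 / c)"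
    unfolding abs_mult by (intro mult_left_mono) auto
  ultimately show "\<bar>- C t * bal A B (z t) - d * (1 - C t / c)\<bar> \<le> (A + B) * exp Z + \<bar>d\<bar> * (1 + 1 / c)"
    by simp
qed

text \<open>Compactness of the simplex does not bound a logarithm. The lower bound b z^2 \<le> V
  does: it keeps z bounded, hence also z', and thus supplies the derivative bound that Barbalat's
  lemma requires.\<close>

lemma z_tendsto_zero_of_lyapunov:
  assumes dV: "\<And>t. T \<le> t \<Longrightarrow> (V has_real_derivative V' t) (at t within {0..})"
    and V': "\<And>t. T \<le> t \<Longrightarrow> V' t \<le> - (k * (z t)\<^sup>2)" and "0 < k"
    and V: "\<And>t. T \<le> t \<Longrightarrow> b * (z t)\<^sup>2 \<le> V t" and "0 < b"
  shows "(z \<longlongrightarrow> 0) at_top"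
proof (rule tendsto_zero_of_square_eventually_less[OF \<open>0 < k\<close>])
  fix \<epsilon> :: real assume "0 < \<epsilon>"
  have mono: "V t \<le> V s" if "T \<le> s" "s \<le> t" for s t
  proof -
    have "V t \<le> V s + 0 * (t - s)"
    proof (rule half_line_derivative_le[where f' = V'])
      fix x assume "s < x" "x < t"
      moreover have "0 \<le> k * (z x)\<^sup>2" using \<open>0 < k\<close> by simp
      ultimately show "V' x \<le> 0" using V'[of x] that by linarith
    qed (use that T_pos dV in auto)
    then show ?thesis by simp
  qed
  have "0 \<le> V t" if "T \<le> t" for t
    using V[OF that] \<open>0 < b\<close> by (smt (verit) mult_nonneg_nonneg zero_le_power2)
  with mono obtain v where v: "(V \<longlongrightarrow> v) at_top"
    using nonincreasing_convergent_at_top[of T V 0] by blast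
  have z_bound: "\<bar>z t\<bar> \<le> sqrt (V T / b)" if "T \<le> t" for t
  proof -
    have "b * (z t)\<^sup>2 \<le> V T" using V[OF that] mono[OF order_refl that] by simp
    then have "(z t)\<^sup>2 \<le> V T / b" using \<open>0 < b\<close> by (simp add: field_simps)
    then show ?thesis by (rule real_le_rsqrt[of "\<bar>z t\<bar>", simplified])
  qed
  obtain K where K: "\<And>t. T \<le> t \<Longrightarrow> \<bar>- C t * bal A B (z t) - d * (1 - C t / c)\<bar> \<le> K"
    using z_rate_bounded[OF z_bound] by blast
  show "\<forall>\<^sub>F t in at_top. k * (z t)\<^sup>2 < \<epsilon>"
  proof (rule barbalat_eventually_less[where T = T and V = V and e = "\<lambda>_. 0"
        and K = "k * (2 * (sqrt (V T / b) * K))"])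
    fix t assume t: "T \<le> t"
    show "((\<lambda>t. k * (z t)\<^sup>2) has_real_derivative
        k * (2 * (z t * (- C t * bal A B (z t) - d * (1 - C t / c))))) (at t within {0..})"
      by (rule DERIV_cmult) (auto intro!: derivative_eq_intros z_derivative_late t)
    have "\<bar>z t * (- C t * bal A B (z t) - d * (1 - C t / c))\<bar> \<le> sqrt (V T / b) * K"
      unfolding abs_mult using z_bound[OF t] K[OF t] order_trans[OF abs_ge_zero z_bound[OF t]]
      by (intro mult_mono) auto
    then have "- (2 * (sqrt (V T / b) * K)) \<le> 2 * (z t * (- C t * bal A B (z t) - d * (1 - C t / c)))"
      by (simp only: abs_le_iff) linarith
    from mult_left_mono[OF this, of k]
    show "- (k * (2 * (sqrt (V T / b) * K)))
        \<le> k * (2 * (z t * (- C t * bal A B (z t) - d * (1 - C t / c))))"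
      using \<open>0 < k\<close> by (simp only: mult_minus_right)
  qed (use T_pos dV V' v \<open>0 < \<epsilon>\<close> in auto)
qed

lemma bal_tendsto_zero:
  assumes "(z \<longlongrightarrow> 0) at_top"
  shows "((\<lambda>t. C t * bal A B (z t)) \<longlongrightarrow> 0) at_top"
proof (rule Lim_null_comparison)
  show "\<forall>\<^sub>F t in at_top. norm (C t * bal A B (z t)) \<le> \<bar>bal A B (z t)\<bar>"
    using in_simplex by (intro eventually_at_top_linorderI[of 0]) (auto simp: abs_mult mult_left_le_one_le)
  have "isCont (bal A B) 0"
    using continuous_bal by (simp add: continuous_on_eq_continuous_at)
  from isCont_tendsto_compose[OF this assms] show "((\<lambda>t. \<bar>bal A B (z t)\<bar>) \<longlongrightarrow> 0) at_top"
    by (simp add: tendsto_rabs_zero)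
qed

text \<open>Barbalat's lemma, applied to \<open>z\<close> itself: a convergent \<open>z\<close> cannot keep drifting at the rate
  \<open>- d * (1 - C / c)\<close>.\<close>
lemma C_tendsto:
  assumes "d \<noteq> 0" "(z \<longlongrightarrow> 0) at_top"
  shows "(C \<longlongrightarrow> c) at_top"
proof -
  obtain K where K: "\<And>t. 0 \<le> t \<Longrightarrow>
      \<bar>mL * L t + mR * R t - C t * ((aL + gLR) * L t + (aR + gRL) * R t)\<bar> \<le> K"
    using derivative_bounds by metis
  define C' where "C' t = mL * L t + mR * R t - C t * ((aL + gLR) * L t + (aR + gRL) * R t)" for t
  \<comment> \<open>Barbalat's lemma bounds the rate from above only; \<sigma> = 1 and \<sigma> = -
    1 together give both sides. The \<open>bal\<close> term tends to 0 and plays the part of the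
    error e.\<close>
  have one_sided: "\<forall>\<^sub>F t in at_top. \<sigma> * (d * (1 - C t / c)) < \<epsilon>" if "\<bar>\<sigma>\<bar> = 1" "0 < \<epsilon>" for \<sigma> \<epsilon>
  proof (rule barbalat_eventually_less[where T = T and V = "\<lambda>t. \<sigma> * z t" and v = "\<sigma> * 0"
        and V' = "\<lambda>t. \<sigma> * (- C t * bal A B (z t) - d * (1 - C t / c))"
        and e = "\<lambda>t. (- \<sigma>) * (C t * bal A B (z t))"
        and \<phi>' = "\<lambda>t. \<sigma> * (d * (- (C' t / c)))" and K = "\<bar>d\<bar> * (K / c)"])
    show "((\<lambda>t. (- \<sigma>) * (C t * bal A B (z t))) \<longlongrightarrow> 0) at_top"
      using tendsto_mult_left[OF bal_tendsto_zero[OF assms(2)], of "- \<sigma>"] by simp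
    show "((\<lambda>t. \<sigma> * z t) \<longlongrightarrow> \<sigma> * 0) at_top"
      by (rule tendsto_mult_left[OF assms(2)])
    fix t assume t: "T \<le> t"
    show "((\<lambda>t. \<sigma> * z t) has_real_derivative \<sigma> * (- C t * bal A B (z t) - d * (1 - C t / c)))
        (at t within {0..})"
      by (rule DERIV_cmult[OF z_derivative_late[OF t]])
    show "((\<lambda>t. \<sigma> * (d * (1 - C t / c))) has_real_derivative \<sigma> * (d * (- (C' t / c)))) (at t within {0..})"
      unfolding C'_def using t T_pos c_pos
      by (intro DERIV_cmult) (auto intro!: derivative_eq_intros C_derivative)
    have "\<bar>\<sigma> * (d * (- (C' t / c)))\<bar> \<le> \<bar>d\<bar> * (K / c)"
      unfolding abs_mult that(1) using K[of t] t T_pos c_pos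
      by (auto simp: abs_mult C'_def intro!: mult_left_mono divide_right_mono)
    then show "- (\<bar>d\<bar> * (K / c)) \<le> \<sigma> * (d * (- (C' t / c)))" by (simp only: abs_le_iff) linarith
  qed (use T_pos that in \<open>auto simp: algebra_simps\<close>)
  have "((\<lambda>t. d * (1 - C t / c)) \<longlongrightarrow> 0) at_top"
    unfolding tendsto_iff dist_real_def
  proof (intro allI impI)
    fix \<epsilon> :: real assume "0 < \<epsilon>"
    with one_sided[of 1 \<epsilon>] one_sided[of "- 1" \<epsilon>]
    show "\<forall>\<^sub>F t in at_top. \<bar>d * (1 - C t / c) - 0\<bar> < \<epsilon>"
      by (auto elim: eventually_elim2 simp: abs_less_iff)
  qed
  then have "((\<lambda>t. c - c / d * (d * (1 - C t / c))) \<longlongrightarrow> c - c / d * 0) at_top"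
    by (intro tendsto_intros)
  moreover have "c - c / d * (d * (1 - C t / c)) = C t" for t
    using assms(1) c_pos by (simp add: field_simps)
  ultimately show ?thesis by simp
qed

text \<open>The quotient L / R = (l / r) exp z and the sum L + R = 1 - C determine R, and then L,
  continuously.\<close>

lemma converges_of_z_C:
  assumes "(z \<longlongrightarrow> 0) at_top" "(C \<longlongrightarrow> c) at_top"
  shows "((\<lambda>t. (L t, R t)) \<longlongrightarrow> (l, r)) at_top"
proof -
  have ex: "((\<lambda>t. exp (z t)) \<longlongrightarrow> 1) at_top" using tendsto_exp[OF assms(1)] by simp
  have "((\<lambda>t. (1 - C t) * r / (l * exp (z t) + r)) \<longlongrightarrow> (1 - c) * r / (l * 1 + r)) at_top"
    using l_pos r_pos by (intro tendsto_intros assms ex) auto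
  moreover have "(1 - c) * r / (l * 1 + r) = r"
    using l_pos r_pos unfolding c_def by (simp add: field_simps)
  moreover have eq: "(1 - C t) * r / (l * exp (z t) + r) = R t" if "T \<le> t" for t
  proof -
    have p: "0 < L t" "0 < R t" using persistent that by auto
    have "R t * (l * exp (z t)) = L t * r"
      unfolding exp_z(1)[OF p] using l_pos r_pos p by (simp add: field_simps)
    then have "(1 - C t) * r = R t * (l * exp (z t) + r)" unfolding C_def by (simp add: algebra_simps)
    moreover have "0 < l * exp (z t) + r" using l_pos r_pos by (intro add_pos_pos) auto
    ultimately show ?thesis by (simp add: divide_eq_eq)
  qed
  ultimately have R: "(R \<longlongrightarrow> r) at_top"
    by (subst (asm) tendsto_cong[where g = R]) (auto intro!: eventually_at_top_linorderI[of T])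
  have "((\<lambda>t. 1 - C t - R t) \<longlongrightarrow> 1 - c - r) at_top" by (intro tendsto_intros assms R)
  then have L: "(L \<longlongrightarrow> l) at_top" unfolding C_def c_def by simp
  from tendsto_Pair[OF L R] show ?thesis .
qed

end

text \<open>Serves to define Theta, whose prescribed derivative is continuous but has a kink where
  the maximum switches.\<close>

lemma continuous_has_antiderivative:
  fixes f :: "real \<Rightarrow> real"
  assumes "continuous_on UNIV f"
  obtains F where "\<And>x. (F has_real_derivative f x) (at x)" "F 0 = 0"
proof
  define F where "F x = (LBINT y=0..x. f y)" for x :: real
  show "F 0 = 0" unfolding F_def by (simp add: zero_ereal_def)
  show "(F has_real_derivative f x) (at x)" for x
  proof -
    define m where "m = \<bar>x\<bar> + 1"
    have "((\<lambda>u. LBINT y=(0::real)..u. f y) has_vector_derivative f x) (at x within {- m..m})"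
      using assms unfolding m_def
      by (intro interval_integral_FTC2) (auto intro: continuous_on_subset)
    moreover have "at x within {- m..m} = at x"
      unfolding m_def by (intro at_within_interior) (simp add: interior_atLeastAtMost_real, linarith)
    ultimately show ?thesis
      unfolding has_real_derivative_iff_has_vector_derivative F_def[abs_def] by (simp add: zero_ereal_def)
  qed
qed

lemma exp_gt_add_one_self:
  fixes x :: real
  shows "x \<noteq> 0 \<Longrightarrow> 0 < exp x - 1 - x"
  using exp_minus_greater[of "- x"] by simp

lemma (in supercritical) persistent_of_solution:
  assumes sol: "is_solution (rad_field aL aR mL mR gRL gLR) x" and start: "x 0 \<in> rad_simplex - {(0, 0)}"
    and c0: "0 < c0" "c0 < c" "c0 < min mL mR / (aL + aR + gRL + gLR + min mL mR)"
  shows "\<exists>T. persistent_trajectory aL aR mL mR gRL gLR l r (\<lambda>t. fst (x t)) (\<lambda>t. snd (x t)) T c0"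
proof -
  interpret simplex_trajectory aL aR mL mR gRL gLR "\<lambda>t. fst (x t)" "\<lambda>t. snd (x t)"
    using simplex_trajectory_of_solution sol start by blast
  have start': "fst (x 0) \<noteq> 0 \<or> snd (x 0) \<noteq> 0" using start by (cases "x 0") auto
  obtain T where T: "0 < T" "\<And>t. T \<le> t \<Longrightarrow> c0 \<le> C t"
    using C_eventually_bounded_below[OF c0(1,3)] by blast
  have "persistent_trajectory aL aR mL mR gRL gLR l r (\<lambda>t. fst (x t)) (\<lambda>t. snd (x t)) T c0"
    by (intro persistent_trajectory.intro supercritical_trajectory.intro persistent_trajectory_axioms.intro)
      (use T c0 interior_after_start[OF start'] supercritical_axioms radical_trajectory_axioms
        simplex_trajectory_axioms in auto)
  then show ?thesis by blast
qed

section \<open>The clipped potential and the drift coordinate\<close>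

context supercritical
begin

text \<open>Because c0 < c, the clipping is inactive at p = 0, where the derivative vanishes.
  Elsewhere the derivative has the sign of p, since the unclipped value 1 - (l + r) exp p decreases
  through c at 0.\<close>

lemma clipped_potential:
  assumes "0 < c0" "c0 < c"
  obtains \<Theta> where "\<And>p. (\<Theta> has_real_derivative 1 / max c0 (1 - (l + r) * exp p) - 1 / c) (at p)"
    "\<Theta> 0 = 0" "\<And>p. p \<noteq> 0 \<Longrightarrow> 0 < \<Theta> p"
proof -
  define f where "f p = 1 / max c0 (1 - (l + r) * exp p) - 1 / c" for p
  have "max c0 (1 - (l + r) * exp p) \<noteq> 0" for p using assms(1) by (simp add: max_def)
  then have "continuous_on UNIV f" unfolding f_def[abs_def] by (intro continuous_intros) auto
  then obtain \<Theta> where \<Theta>: "\<And>p. (\<Theta> has_real_derivative f p) (at p)" "\<Theta> 0 = 0"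
    using continuous_has_antiderivative by blast
  have f_pos: "0 < f p" if "0 < p" for p
  proof -
    have "(l + r) * 1 < (l + r) * exp p" using that l_pos r_pos by (intro mult_strict_left_mono) auto
    then have "max c0 (1 - (l + r) * exp p) < c" using assms(2) unfolding c_def by simp
    moreover have "0 < max c0 (1 - (l + r) * exp p)" using assms(1) by simp
    ultimately show ?thesis unfolding f_def by (simp add: frac_less2)
  qed
  have f_neg: "f p < 0" if "p < 0" for p
  proof -
    have "(l + r) * exp p < (l + r) * 1" using that l_pos r_pos by (intro mult_strict_left_mono) auto
    then have "c < max c0 (1 - (l + r) * exp p)" unfolding c_def by simp
    then show ?thesis using c_pos unfolding f_def by (simp add: frac_less2)
  qed
  have cont: "continuous_on S \<Theta>" for S
    using \<Theta>(1) by (meson DERIV_continuous continuous_at_imp_continuous_on)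
  have "0 < \<Theta> p" if "p \<noteq> 0" for p
  proof (cases "0 < p")
    case True
    have "\<Theta> 0 < \<Theta> p"
      by (rule DERIV_pos_imp_increasing_open[OF True _ cont]) (use \<Theta>(1) f_pos in blast)
    then show ?thesis using \<Theta>(2) by simp
  next
    case False
    then have "p < 0" using that by simp
    have "\<Theta> 0 < \<Theta> p"
      by (rule DERIV_neg_imp_decreasing_open[OF \<open>p < 0\<close> _ cont]) (use \<Theta>(1) f_neg in blast)
    then show ?thesis using \<Theta>(2) by simp
  qed
  with \<Theta> show ?thesis using that unfolding f_def by blast
qed

text \<open>The weights are chosen so that the terms \<open>mL * (1 - C / c)\<close> and \<open>mR * (1 - C / c)\<close> in the
  derivatives of the two logarithms cancel.\<close>
definition drift :: "real \<times> real \<Rightarrow> real" where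
  "drift q = (mL * ln (snd q / r) - mR * ln (fst q / l)) / d"

lemma drift_equilibrium [simp]: "drift (l, r) = 0"
  using l_pos r_pos by (simp add: drift_def)

text \<open>The inverse of the change of coordinates from (x, y) to log-ratio and drift. Both
  exponents are positive multiples of the log-ratio divided by d, so x and y move in the same
  direction when the drift is held fixed.\<close>

lemma coordinates_of_drift:
  assumes "d \<noteq> 0" "0 < x" "0 < y"
  shows "x = l * exp (drift (x, y)) * exp (mL * (logratio (x, y) / d))"
    "y = r * exp (drift (x, y)) * exp (mR * (logratio (x, y) / d))"
proof -
  have "drift (x, y) + mL * (logratio (x, y) / d) = ln (x / l) * ((mL - mR) / d)"
    "drift (x, y) + mR * (logratio (x, y) / d) = ln (y / r) * ((mL - mR) / d)"
    unfolding drift_def logratio_def using assms(1) by (simp_all add: field_simps)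
  then have "drift (x, y) + mL * (logratio (x, y) / d) = ln (x / l)"
    "drift (x, y) + mR * (logratio (x, y) / d) = ln (y / r)"
    using assms(1) unfolding d_def by auto
  then have "exp (drift (x, y)) * exp (mL * (logratio (x, y) / d)) = x / l"
    "exp (drift (x, y)) * exp (mR * (logratio (x, y) / d)) = y / r"
    unfolding exp_add[symmetric] using assms(2,3) l_pos r_pos by auto
  then show "x = l * exp (drift (x, y)) * exp (mL * (logratio (x, y) / d))"
    "y = r * exp (drift (x, y)) * exp (mR * (logratio (x, y) / d))"
    using l_pos r_pos by (simp_all add: mult.assoc)
qed

text \<open>For fixed drift, \<open>1 - x - y\<close> decreases in \<open>logratio (x, y) / d\<close>; on \<open>c0 \<le> 1 - x - y\<close>
  replacing its value at log-ratio 0 by the maximum with \<open>c0\<close> preserves the comparison.\<close>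
lemma clipped_comparison:
  assumes "d \<noteq> 0" "0 < x" "0 < y" "0 < c0" "c0 \<le> 1 - x - y" "0 < a" "0 < b"
  shows "0 \<le> d * bal a b (logratio (x, y)) *
    (1 / (1 - x - y) - 1 / max c0 (1 - (l + r) * exp (drift (x, y))))"
proof -
  define z where "z = logratio (x, y)"
  define w where "w = z / d"
  define p where "p = exp (drift (x, y))"
  define m where "m = max c0 (1 - (l + r) * p)"
  have p: "0 < p" "x = l * p * exp (mL * w)" "y = r * p * exp (mR * w)"
    using coordinates_of_drift[OF assms(1-3)] unfolding p_def w_def z_def by auto
  have m: "0 < m" unfolding m_def using assms(4) by simp
  have zd: "z = d * w" unfolding w_def using assms(1) by simp
  have "0 \<le> d * bal a b z * (1 / (1 - x - y) - 1 / m)"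
  proof (cases "0 \<le> w")
    case True
    have "l * p * 1 \<le> x" "r * p * 1 \<le> y"
      unfolding p(2,3) using l_pos r_pos p(1) pos True by (intro mult_left_mono; simp)+
    then have "1 - x - y \<le> m" unfolding m_def by (simp add: algebra_simps)
    then have "0 \<le> 1 / (1 - x - y) - 1 / m" using m assms(4,5) by (simp add: frac_le)
    moreover have "0 \<le> d * bal a b z"
    proof -
      have "0 \<le> z * bal a b z" using bal_sign[OF assms(6,7), of z] assms(6,7)
        by (smt (verit) mult_nonneg_nonneg min_def zero_le_power2)
      then have "0 \<le> w * (d * bal a b z)" unfolding zd by (simp add: mult.commute mult.left_commute)
      then show ?thesis using True by (cases "w = 0") (auto simp: zd zero_le_mult_iff)
    qed
    ultimately show ?thesis by simp
  next
    case False
    have "x \<le> l * p * 1" "y \<le> r * p * 1"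
      unfolding p(2,3) using l_pos r_pos p(1) pos False
      by (intro mult_left_mono; simp add: mult_nonneg_nonpos)+
    then have "m \<le> 1 - x - y" unfolding m_def using assms(5) by (simp add: algebra_simps)
    then have "1 / (1 - x - y) - 1 / m \<le> 0" using m by (simp add: frac_le)
    moreover have "d * bal a b z \<le> 0"
    proof -
      have "0 \<le> z * bal a b z" using bal_sign[OF assms(6,7), of z] assms(6,7)
        by (smt (verit) mult_nonneg_nonneg min_def zero_le_power2)
      then have "0 \<le> w * (d * bal a b z)" unfolding zd by (simp add: mult.commute mult.left_commute)
      then show ?thesis using False by (simp add: zero_le_mult_iff)
    qed
    ultimately show ?thesis by (simp add: mult_nonpos_nonpos)
  qed
  then show ?thesis unfolding z_def m_def p_def .
qed

lemma continuous_on_logratio: "continuous_on ({0<..} \<times> {0<..}) logratio"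
  unfolding logratio_def[abs_def] using l_pos r_pos by (intro continuous_intros) auto

lemma continuous_on_drift: "continuous_on ({0<..} \<times> {0<..}) drift"
  unfolding drift_def[abs_def] d_def divide_inverse[of _ "mL - mR"]
  using l_pos r_pos by (intro continuous_intros) auto

end

lemma (in supercritical_trajectory) drift_derivative:
  assumes "0 \<le> t" "0 < L t" "0 < R t"
  shows "((\<lambda>t. drift (L t, R t)) has_real_derivative C t * bal (mR * A) (mL * B) (z t) / d)
    (at t within {0..})"
proof -
  have "((\<lambda>t. (mL * ln (R t / r) - mR * ln (L t / l)) / d) has_real_derivative
     (mL * (C t * (B * (exp (z t) - 1)) - mR * (1 - C t / c))
      - mR * (- C t * (A * (1 - exp (- z t))) - mL * (1 - C t / c))) / d) (at t within {0..})"
    by (intro DERIV_cdivide DERIV_diff DERIV_cmult log_L_derivative log_R_derivative assms)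
  moreover have "mL * (C t * (B * (exp (z t) - 1)) - mR * (1 - C t / c))
      - mR * (- C t * (A * (1 - exp (- z t))) - mL * (1 - C t / c))
      = C t * bal (mR * A) (mL * B) (z t)"
    unfolding bal_def by (simp add: algebra_simps)
  ultimately show ?thesis by (simp add: drift_def)
qed

section \<open>Lyapunov functions for unequal and for equal exit rates\<close>

context supercritical
begin

text \<open>A common interface for the two constructions, with w as guaranteed dissipation. The
  conditions on the trajectory concern the single time t, so the same function serves near the
  equilibrium (stability) and along the tail of a persistent trajectory (convergence).\<close>

definition lyapunov :: "real \<Rightarrow> (real \<times> real \<Rightarrow> real) \<Rightarrow> (real \<times> real \<Rightarrow> real) \<Rightarrow> bool" where
  "lyapunov c0 V w \<longleftrightarrow> continuous_on ({0<..} \<times> {0<..}) V \<and> V (l, r) = 0 \<and> (\<forall>q. 0 \<le> w q) \<and>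
    (\<forall>x y. 0 < x \<longrightarrow> 0 < y \<longrightarrow> (x, y) \<noteq> (l, r) \<longrightarrow> 0 < V (x, y)) \<and>
    (\<forall>L R t. radical_trajectory aL aR mL mR gRL gLR L R \<longrightarrow> 0 \<le> t \<longrightarrow> 0 < L t \<longrightarrow> 0 < R t \<longrightarrow>
      c0 \<le> 1 - L t - R t \<longrightarrow>
      (\<exists>D \<le> - w (L t, R t). ((\<lambda>t. V (L t, R t)) has_real_derivative D) (at t within {0..})))"

lemma lyapunov_nonneg:
  assumes "lyapunov c0 V w" "0 < x" "0 < y"
  shows "0 \<le> V (x, y)"
  using assms unfolding lyapunov_def by (cases "(x, y) = (l, r)") (auto intro: less_imp_le)

lemma lyapunov_rate:
  assumes "lyapunov c0 V w" "radical_trajectory aL aR mL mR gRL gLR L R" "0 \<le> t" "0 < L t" "0 < R t"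
    "c0 \<le> 1 - L t - R t"
  shows "\<exists>D \<le> - w (L t, R t). ((\<lambda>t. V (L t, R t)) has_real_derivative D) (at t within {0..})"
  using assms unfolding lyapunov_def by blast

lemma stable_of_lyapunov_function:
  assumes "lyapunov c0 V w" "c0 < c" "0 < \<epsilon>"
  shows "\<exists>\<delta>>0. \<forall>x. is_solution (rad_field aL aR mL mR gRL gLR) x \<and> x 0 \<in> S \<and> dist (x 0) (l, r) < \<delta>
    \<longrightarrow> (\<forall>t\<ge>0. dist (x t) (l, r) < \<epsilon>)"
proof (rule stable_of_lyapunov[OF _ _ assms(2) _ assms(3)])
  show "continuous_on ({0<..} \<times> {0<..}) V" using assms(1) unfolding lyapunov_def by blast
  show "V (l, r) < V (x, y)" if "0 < x" "0 < y" "(x, y) \<noteq> (l, r)" for x y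
    using assms(1) that unfolding lyapunov_def by simp
  show "\<exists>D\<le>0. ((\<lambda>t. V (L t, R t)) has_real_derivative D) (at t within {0..})"
    if "radical_trajectory aL aR mL mR gRL gLR L R" "0 \<le> t" "0 < L t" "0 < R t" "c0 \<le> 1 - L t - R t" for L R t
  proof -
    have "0 \<le> w (L t, R t)" using assms(1) unfolding lyapunov_def by blast
    then show ?thesis using lyapunov_rate[OF assms(1) that] by (meson neg_le_0_iff_le order_trans)
  qed
qed

lemma lyapunov_unequal_exit_rates:
  assumes "d \<noteq> 0" "0 < c0" "c0 < c"
  shows "\<exists>k b V. 0 < k \<and> 0 < b \<and> lyapunov c0 V (\<lambda>q. k * (logratio q)\<^sup>2) \<and>
    (\<forall>x y. b * (logratio (x, y))\<^sup>2 \<le> V (x, y))"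
proof -
  obtain \<Theta> where \<Theta>: "\<And>p. (\<Theta> has_real_derivative 1 / max c0 (1 - (l + r) * exp p) - 1 / c) (at p)"
    "\<Theta> 0 = 0" "\<And>p. p \<noteq> 0 \<Longrightarrow> 0 < \<Theta> p"
    using clipped_potential[OF assms(2,3)] by blast
  \<comment> \<open>The coefficients of G, read off from the derivative of the drift.\<close>
  define a' where "a' = mR * A"
  define b' where "b' = mL * B"
  have ab': "0 < a'" "0 < b'" unfolding a'_def b'_def using pos A_pos B_pos by auto
  define b where "b = min a' b' / 2"
  define k where "k = c0 * (min a' b' * min A B)"
  have kb: "0 < k" "0 < b" unfolding k_def b_def using ab' A_pos B_pos assms by auto
  define V where "V q = bal_pot a' b' (logratio q) + d\<^sup>2 * \<Theta> (drift q)" for q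
  have \<Theta>_nonneg: "0 \<le> \<Theta> p" for p using \<Theta>(2) \<Theta>(3)[of p] by (cases "p = 0") auto
  have pot: "b * u\<^sup>2 \<le> bal_pot a' b' u" for u
    using bal_pot_ge[OF ab', of u] unfolding b_def by simp
  have lower: "b * (logratio (x, y))\<^sup>2 \<le> V (x, y)" for x y
  proof -
    have "0 \<le> d\<^sup>2 * \<Theta> (drift (x, y))" using \<Theta>_nonneg by simp
    then show ?thesis using pot[of "logratio (x, y)"] unfolding V_def by linarith
  qed
  have "continuous_on UNIV \<Theta>"
    using \<Theta>(1) by (meson DERIV_continuous continuous_at_imp_continuous_on)
  moreover have "continuous_on UNIV (bal_pot a' b')"
    using bal_pot_derivative by (meson DERIV_continuous continuous_at_imp_continuous_on)
  ultimately have "continuous_on ({0<..} \<times> {0<..}) (\<lambda>q. \<Theta> (drift q))"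
    "continuous_on ({0<..} \<times> {0<..}) (\<lambda>q. bal_pot a' b' (logratio q))"
    using continuous_on_compose2[OF _ continuous_on_drift subset_UNIV]
      continuous_on_compose2[OF _ continuous_on_logratio subset_UNIV] by blast+
  then have cont: "continuous_on ({0<..} \<times> {0<..}) V"
    unfolding V_def[abs_def] by (intro continuous_on_add continuous_on_mult_left)
  have zero: "V (l, r) = 0" unfolding V_def by (simp add: \<Theta>(2) bal_pot_def)
  have positive: "0 < V (x, y)" if "0 < x" "0 < y" "(x, y) \<noteq> (l, r)" for x y
  proof (cases "logratio (x, y) = 0")
    case False
    then have "0 < b * (logratio (x, y))\<^sup>2" using kb(2) by simp
    then show ?thesis using lower[of x y] by linarith
  next
    case True
    have "drift (x, y) \<noteq> 0"
    proof
      assume "drift (x, y) = 0"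
      then have "x = l" "y = r" using coordinates_of_drift[OF assms(1) that(1,2)] True by auto
      then show False using that(3) by simp
    qed
    then have "0 < d\<^sup>2 * \<Theta> (drift (x, y))" using \<Theta>(3) assms(1) by simp
    then show ?thesis using True unfolding V_def by (simp add: bal_pot_def)
  qed
  have decrease: "\<exists>D \<le> - (k * (logratio (L t, R t))\<^sup>2).
      ((\<lambda>t. V (L t, R t)) has_real_derivative D) (at t within {0..})"
    if traj: "radical_trajectory aL aR mL mR gRL gLR L R"
      and t: "0 \<le> t" "0 < L t" "0 < R t" and low: "c0 \<le> 1 - L t - R t" for L R t
  proof -
    interpret supercritical_trajectory aL aR mL mR gRL gLR l r L R
      using traj supercritical_axioms by (simp add: supercritical_trajectory_def)
    define F where "F = bal A B (z t)"
    define G where "G = bal a' b' (z t)"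
    define h where "h = 1 / max c0 (1 - (l + r) * exp (drift (L t, R t))) - 1 / c"
    define D where "D = G * (- C t * F - d * (1 - C t / c)) + d\<^sup>2 * (h * (C t * G / d))"
    have C: "c0 \<le> C t" "0 < C t" using low assms(2) unfolding C_def by auto
    have "((\<lambda>t. V (L t, R t)) has_real_derivative D) (at t within {0..})"
      unfolding V_def D_def F_def G_def h_def a'_def b'_def z_def[symmetric]
      by (intro DERIV_add DERIV_cmult DERIV_chain2[OF bal_pot_derivative] DERIV_chain2[OF \<Theta>(1)]
          z_derivative drift_derivative t)
    \<comment> \<open>\<open>h + 1 / c\<close> is the reciprocal of the clipped value. Taking the
      factor \<open>C t\<close> out of the coupling terms leaves the difference of reciprocals whose
      sign \<open>clipped_comparison\<close> determines.\<close>
    moreover have "D = - C t * (G * F) - C t * (d * G * (1 / C t - (h + 1 / c)))"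
      unfolding D_def using assms(1) C(2) c_pos by (simp add: field_simps power2_eq_square)
    moreover have "0 \<le> d * G * (1 / C t - (h + 1 / c))"
      using clipped_comparison[OF assms(1) t(2,3) assms(2) low ab']
      unfolding G_def h_def z_def C_def by simp
    then have "0 \<le> C t * (d * G * (1 / C t - (h + 1 / c)))" by (rule mult_nonneg_nonneg[OF less_imp_le[OF C(2)]])
    moreover have "c0 * (min a' b' * min A B * (z t)\<^sup>2) \<le> C t * (G * F)"
      unfolding G_def F_def using bal_mult_ge[OF ab' A_pos B_pos, of "z t"] C ab' A_pos B_pos assms(2)
      by - (rule mult_mono, auto)
    then have "k * (z t)\<^sup>2 \<le> C t * (G * F)" unfolding k_def by (simp add: mult.assoc)
    ultimately show ?thesis unfolding z_def[symmetric] by (intro exI[of _ D]) auto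
  qed
  have "lyapunov c0 V (\<lambda>q. k * (logratio q)\<^sup>2)"
    unfolding lyapunov_def using cont zero positive decrease kb(1) by simp
  then show ?thesis using kb lower by (intro exI[of _ k] exI[of _ b] exI[of _ V]) simp
qed

text \<open>The drift coordinate degenerates for d = 0, but the system becomes a cascade: z evolves
  without drift and disturbs y = R / r through a term with bounded coefficient, which enough
  dissipation in z can absorb. The recorded dissipation keeps only the part in y, as z can be
  treated on its own.\<close>

lemma lyapunov_equal_exit_rates:
  assumes "d = 0" "0 < c0"
  shows "\<exists>k V. 0 < k \<and> lyapunov c0 V (\<lambda>q. k * (snd q / r - 1)\<^sup>2)"
proof -
  \<comment> \<open>m is the damping of y - 1, and K bounds the coefficient of the cross term (y -
    1) E with E = exp z - 1. Young's inequality splits this term at the cost of q E^2 and half of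
    the damping; M is chosen so that the z-part dissipates 2 q E^2.\<close>
  define m where "m = mR * (l + r) / c"
  define K where "K = B + mR * l / (c * r)"
  define q where "q = K\<^sup>2 / (2 * m)"
  define M where "M = 2 * q / (c0 * B)"
  have m: "0 < m" unfolding m_def using pos l_pos r_pos c_pos by simp
  have K: "0 < K" unfolding K_def using pos l_pos r_pos c_pos B_pos by (simp add: add_pos_pos)
  have q: "0 < q" unfolding q_def using m K by simp
  have M: "0 < M" "M * (c0 * B) = 2 * q" unfolding M_def using q assms(2) B_pos by auto
  define V where "V p = M * (exp (logratio p) - 1 - logratio p)
    + (exp (ln (snd p / r)) - 1 - ln (snd p / r))" for p
  have cont: "continuous_on ({0<..} \<times> {0<..}) V"
    unfolding V_def[abs_def] using r_pos by (intro continuous_intros continuous_on_logratio) auto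
  have zero: "V (l, r) = 0" unfolding V_def using r_pos by simp
  have nonneg: "0 \<le> exp u - 1 - u" for u :: real using exp_ge_add_one_self[of u] by linarith
  have positive: "0 < V (x, y)" if "0 < x" "0 < y" "(x, y) \<noteq> (l, r)" for x y
  proof (cases "y = r")
    case True
    then have "x \<noteq> l" using that by simp
    then have "logratio (x, y) \<noteq> 0"
      using True that(1) l_pos r_pos by (simp add: logratio_def)
    then have "0 < M * (exp (logratio (x, y)) - 1 - logratio (x, y))"
      using exp_gt_add_one_self M by simp
    then show ?thesis using nonneg[of "ln (y / r)"] unfolding V_def by simp
  next
    case False
    then have "ln (y / r) \<noteq> 0" using that(2) r_pos by simp
    then have "0 < exp (ln (y / r)) - 1 - ln (y / r)" by (rule exp_gt_add_one_self)
    moreover have "0 \<le> M * (exp (logratio (x, y)) - 1 - logratio (x, y))" using nonneg M by simp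
    ultimately show ?thesis unfolding V_def by simp
  qed
  have decrease: "\<exists>D \<le> - (m / 2 * (R t / r - 1)\<^sup>2).
      ((\<lambda>t. V (L t, R t)) has_real_derivative D) (at t within {0..})"
    if traj: "radical_trajectory aL aR mL mR gRL gLR L R"
      and t: "0 \<le> t" "0 < L t" "0 < R t" and low: "c0 \<le> 1 - L t - R t" for L R t
  proof -
    interpret supercritical_trajectory aL aR mL mR gRL gLR l r L R
      using traj supercritical_axioms by (simp add: supercritical_trajectory_def)
    define E where "E = exp (z t) - 1"
    define y where "y = R t / r"
    define D where "D = M * (E * (- C t * bal A B (z t) - d * (1 - C t / c)))
      + (y - 1) * (C t * (B * (exp (z t) - 1)) - mR * (1 - C t / c))"
    have C: "c0 \<le> C t" "0 < C t" "C t \<le> 1" using low assms(2) t unfolding C_def by auto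
    have y: "0 < y" "y \<le> 1 / r" "exp (ln (R t / r)) = y"
      unfolding y_def using t r_pos low assms(2) by (auto simp: divide_right_mono)
    have dpot: "((\<lambda>u. exp u - 1 - u) has_real_derivative exp u - 1) (at u)" for u :: real
      by (auto intro!: derivative_eq_intros)
    have "((\<lambda>t. M * (exp (z t) - 1 - z t) + (exp (ln (R t / r)) - 1 - ln (R t / r)))
        has_real_derivative M * ((exp (z t) - 1) * (- C t * bal A B (z t) - d * (1 - C t / c)))
          + (exp (ln (R t / r)) - 1) * (C t * (B * (exp (z t) - 1)) - mR * (1 - C t / c))) (at t within {0..})"
      by (intro DERIV_add DERIV_cmult DERIV_chain2[OF dpot] z_derivative log_R_derivative t)
    then have "((\<lambda>t. V (L t, R t)) has_real_derivative D) (at t within {0..})"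
      unfolding D_def y(3) E_def by (simp add: V_def z_def)
    moreover have "D \<le> - (m / 2 * (y - 1)\<^sup>2)"
    proof -
      define X where "X = mR * l * y / c"
      have X: "0 \<le> X" "X \<le> K - B"
      proof -
        show "0 \<le> X" unfolding X_def using pos l_pos c_pos y by simp
        have "mR * l / c * y \<le> mR * l / c * (1 / r)"
          using pos l_pos c_pos y by (intro mult_left_mono) auto
        then show "X \<le> K - B" unfolding X_def K_def by simp
      qed
      have "L t = l * (E + 1) * y"
        unfolding E_def y_def using exp_z(1)[OF t(2,3)] t l_pos r_pos by simp
      \<comment> \<open>have "L t = l * (E + 1) * y"\<close>
      moreover have "R t = r * y" unfolding y_def using r_pos by simp
      ultimately have "c - C t = l * E * y + (l + r) * (y - 1)"
        unfolding c_def C_def by (simp add: algebra_simps)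
      moreover have "mR * (1 - C t / c) = mR * (c - C t) / c" using c_pos by (simp add: field_simps)
      ultimately have "mR * (1 - C t / c) = mR * (l * E * y + (l + r) * (y - 1)) / c" by simp
      also have "\<dots> = X * E + m * (y - 1)"
        unfolding X_def m_def using c_pos by (simp add: field_simps)
      finally have exit: "mR * (1 - C t / c) = X * E + m * (y - 1)" .
      have split: "D = - M * (C t * (E * bal A B (z t))) + (y - 1) * E * (C t * B - X) - m * (y - 1)\<^sup>2"
        unfolding D_def exit assms(1) E_def[symmetric] by (simp add: algebra_simps power2_eq_square)
      have "0 \<le> E * (1 - exp (- z t))"
        unfolding E_def by (cases "0 \<le> z t") (auto intro: mult_nonneg_nonneg mult_nonpos_nonpos)
      then have "0 \<le> A * (E * (1 - exp (- z t)))" using A_pos by simp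
      then have "B * E\<^sup>2 \<le> E * bal A B (z t)"
        unfolding bal_def E_def[symmetric] by (simp add: algebra_simps power2_eq_square)
      then have "c0 * (B * E\<^sup>2) \<le> C t * (E * bal A B (z t))"
        using C B_pos assms(2) by - (rule mult_mono, auto)
      from mult_left_mono[OF this, of M]
      have "M * (c0 * (B * E\<^sup>2)) \<le> M * (C t * (E * bal A B (z t)))" using M(1) by simp
      moreover have "M * (c0 * (B * E\<^sup>2)) = M * (c0 * B) * E\<^sup>2" by simp
      ultimately have first: "2 * q * E\<^sup>2 \<le> M * (C t * (E * bal A B (z t)))"
        unfolding M(2) by simp
      have "C t * B \<le> 1 * B" "0 \<le> C t * B" using C B_pos by (auto intro: mult_right_mono)
      then have "\<bar>C t * B - X\<bar> \<le> K" using X unfolding abs_le_iff by linarith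
      then have "\<bar>(y - 1) * E * (C t * B - X)\<bar> \<le> \<bar>y - 1\<bar> * \<bar>E\<bar> * K"
        unfolding abs_mult by (intro mult_left_mono) auto
      then have "(y - 1) * E * (C t * B - X) \<le> \<bar>y - 1\<bar> * \<bar>E\<bar> * K" by simp
      moreover have "0 \<le> (K * \<bar>E\<bar> - m * \<bar>y - 1\<bar>)\<^sup>2 / (2 * m)" using m by simp
      then have "\<bar>y - 1\<bar> * \<bar>E\<bar> * K \<le> q * E\<^sup>2 + m / 2 * (y - 1)\<^sup>2"
        unfolding q_def power2_diff using m by (simp add: power_mult_distrib field_simps power2_eq_square)
      moreover have "0 \<le> q * E\<^sup>2" using q by simp
      ultimately show ?thesis unfolding split using first by simp
    qed
    ultimately show ?thesis unfolding y_def by blast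
  qed
  have "lyapunov c0 V (\<lambda>q. m / 2 * (snd q / r - 1)\<^sup>2)"
    unfolding lyapunov_def using cont zero positive decrease m by simp
  then show ?thesis using m by (intro exI[of _ "m / 2"] exI[of _ V]) simp
qed

end

context persistent_trajectory
begin

lemma lyapunov_late_rate:
  assumes "lyapunov c0 V w"
  shows "\<exists>V'. \<forall>t\<ge>T. V' t \<le> - w (L t, R t) \<and>
    ((\<lambda>t. V (L t, R t)) has_real_derivative V' t) (at t within {0..})"
proof -
  have "\<forall>t. \<exists>D. T \<le> t \<longrightarrow> D \<le> - w (L t, R t) \<and>
      ((\<lambda>t. V (L t, R t)) has_real_derivative D) (at t within {0..})"
  proof
    fix t
    show "\<exists>D. T \<le> t \<longrightarrow> D \<le> - w (L t, R t) \<and>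
        ((\<lambda>t. V (L t, R t)) has_real_derivative D) (at t within {0..})"
    proof (cases "T \<le> t")
      case True
      have "c0 \<le> 1 - L t - R t" using persistent(3)[OF True] unfolding C_def .
      moreover have "0 \<le> t" using True T_pos by simp
      ultimately show ?thesis
        using lyapunov_rate[OF assms radical_trajectory_axioms _ persistent(1,2)[OF True]] by blast
    qed simp
  qed
  then show ?thesis by (rule choice)
qed

lemma converges_unequal_exit_rates:
  assumes "d \<noteq> 0"
  shows "((\<lambda>t. (L t, R t)) \<longlongrightarrow> (l, r)) at_top"
proof -
  obtain k b V where V: "0 < k" "0 < b" "lyapunov c0 V (\<lambda>q. k * (logratio q)\<^sup>2)"
    "\<forall>x y. b * (logratio (x, y))\<^sup>2 \<le> V (x, y)"
    using lyapunov_unequal_exit_rates[OF assms c0] by (elim exE conjE) (rule that)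
  obtain V' where V': "\<forall>t\<ge>T. V' t \<le> - (k * (z t)\<^sup>2) \<and>
      ((\<lambda>t. V (L t, R t)) has_real_derivative V' t) (at t within {0..})"
    using lyapunov_late_rate[OF V(3)] unfolding z_def[symmetric] ..
  have "(z \<longlongrightarrow> 0) at_top"
  proof (rule z_tendsto_zero_of_lyapunov[OF _ _ V(1) _ V(2)])
    show "b * (z t)\<^sup>2 \<le> V (L t, R t)" for t using V(4) unfolding z_def by simp
  qed (use V' in auto)
  then show ?thesis using C_tendsto[OF assms] converges_of_z_C by blast
qed

lemma converges_equal_exit_rates:
  assumes "d = 0"
  shows "((\<lambda>t. (L t, R t)) \<longlongrightarrow> (l, r)) at_top"
proof -
  have z: "(z \<longlongrightarrow> 0) at_top"
  proof (rule z_tendsto_zero_of_lyapunov)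
    fix t assume t: "T \<le> t"
    show "((\<lambda>t. (z t)\<^sup>2) has_real_derivative 2 * (z t * (- C t * bal A B (z t) - d * (1 - C t / c))))
        (at t within {0..})"
      by (auto intro!: derivative_eq_intros z_derivative_late t)
    have "c0 * (min A B * (z t)\<^sup>2) \<le> C t * (z t * bal A B (z t))"
      using bal_sign[OF A_pos B_pos, of "z t"] persistent(3)[OF t] c0 A_pos B_pos
      by - (rule mult_mono, auto)
    then show "2 * (z t * (- C t * bal A B (z t) - d * (1 - C t / c))) \<le> - (2 * (c0 * min A B) * (z t)\<^sup>2)"
      unfolding assms by (simp add: algebra_simps)
    show "1 * (z t)\<^sup>2 \<le> (z t)\<^sup>2" by simp
  next
    show "0 < 2 * (c0 * min A B)" using c0 A_pos B_pos by simp
  qed simp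
  obtain k V where V: "0 < k" "lyapunov c0 V (\<lambda>q. k * (snd q / r - 1)\<^sup>2)"
    using lyapunov_equal_exit_rates[OF assms c0(1)] by (elim exE conjE) (rule that)
  obtain V' where "\<forall>t\<ge>T. V' t \<le> - (k * (R t / r - 1)\<^sup>2) \<and>
      ((\<lambda>t. V (L t, R t)) has_real_derivative V' t) (at t within {0..})"
    using lyapunov_late_rate[OF V(2)] unfolding snd_conv ..
  then have V': "\<And>t. T \<le> t \<Longrightarrow> ((\<lambda>t. V (L t, R t)) has_real_derivative V' t) (at t within {0..})"
    "\<And>t. T \<le> t \<Longrightarrow> V' t \<le> - (k * (R t / r - 1)\<^sup>2)"
    by simp_all
  obtain v where v: "((\<lambda>t. V (L t, R t)) \<longlongrightarrow> v) at_top"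
  proof (rule nonincreasing_convergent_at_top[where V = "\<lambda>t. V (L t, R t)" and T = T and m = 0])
    show "0 \<le> V (L t, R t)" if "T \<le> t" for t
      using lyapunov_nonneg[OF V(2) persistent(1,2)] that by blast
    fix s t assume st: "T \<le> s" "s \<le> t"
    have "V (L t, R t) \<le> V (L s, R s) + 0 * (t - s)"
    proof (rule half_line_derivative_le[where f' = V'])
      fix x assume "s < x" "x < t"
      moreover have "0 \<le> k * (R x / r - 1)\<^sup>2" using V(1) by simp
      ultimately show "V' x \<le> 0" using V'(2)[of x] st by simp
    qed (use st T_pos V'(1) in auto)
    then show "V (L t, R t) \<le> V (L s, R s)" by simp
  qed
  define R' where "R' t = aR * R t * C t - mR * R t + gLR * L t * C t" for t
  obtain K where K: "\<And>t. 0 \<le> t \<Longrightarrow> \<bar>R' t\<bar> \<le> K" "0 \<le> K"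
    using derivative_bounds unfolding R'_def by metis
  have "((\<lambda>t. R t / r - 1) \<longlongrightarrow> 0) at_top"
  proof (rule tendsto_zero_of_square_eventually_less[OF V(1)])
    fix \<epsilon> :: real assume "0 < \<epsilon>"
    show "\<forall>\<^sub>F t in at_top. k * (R t / r - 1)\<^sup>2 < \<epsilon>"
    proof (rule barbalat_eventually_less[where T = T and V = "\<lambda>t. V (L t, R t)" and e = "\<lambda>_. 0"
          and K = "k * (2 * ((1 / r + 1) * (K / r)))"])
      fix t assume t: "T \<le> t"
      then have t0: "0 \<le> t" using T_pos by simp
      show "((\<lambda>t. k * (R t / r - 1)\<^sup>2) has_real_derivative k * (2 * ((R t / r - 1) * (R' t / r))))
          (at t within {0..})"
        unfolding R'_def using r_pos
        by (intro DERIV_cmult) (auto intro!: derivative_eq_intros R_derivative t0)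
      have "R t / r \<le> 1 / r" "0 \<le> R t / r"
        using in_simplex[OF t0] r_pos by (auto simp: divide_right_mono)
      then have "\<bar>R t / r - 1\<bar> \<le> 1 / r + 1" unfolding abs_le_iff by linarith
      moreover have "\<bar>R' t / r\<bar> \<le> K / r" using K(1)[OF t0] r_pos by (simp add: divide_right_mono)
      ultimately have "\<bar>(R t / r - 1) * (R' t / r)\<bar> \<le> (1 / r + 1) * (K / r)"
        unfolding abs_mult using r_pos by (intro mult_mono) auto
      then have "- (2 * ((1 / r + 1) * (K / r))) \<le> 2 * ((R t / r - 1) * (R' t / r))"
        by (simp only: abs_le_iff) linarith
      from mult_left_mono[OF this, of k]
      show "- (k * (2 * ((1 / r + 1) * (K / r)))) \<le> k * (2 * ((R t / r - 1) * (R' t / r)))"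
        using V(1) by (simp only: mult_minus_right)
    qed (use T_pos V' v \<open>0 < \<epsilon>\<close> in auto)
  qed
  then have "((\<lambda>t. r * (R t / r - 1) + r) \<longlongrightarrow> r * 0 + r) at_top" by (intro tendsto_intros)
  then have R: "(R \<longlongrightarrow> r) at_top" using r_pos by (simp add: algebra_simps)
  have "((\<lambda>t. 1 - l * exp (z t) * R t / r - R t) \<longlongrightarrow> 1 - l * exp 0 * r / r - r) at_top"
    using r_pos by (intro tendsto_intros z R) auto
  moreover have "1 - l * exp (z t) * R t / r - R t = C t" if "T \<le> t" for t
    using exp_z(1)[OF persistent(1,2)[OF that]] persistent(1,2)[OF that] l_pos r_pos
    unfolding C_def by simp
  ultimately have "(C \<longlongrightarrow> 1 - l * exp 0 * r / r - r) at_top"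
    by (subst (asm) tendsto_cong[where g = C]) (auto intro!: eventually_at_top_linorderI[of T])
  then have "(C \<longlongrightarrow> c) at_top" using r_pos unfolding c_def by simp
  then show ?thesis using converges_of_z_C z by blast
qed

end

theorem (in supercritical) equilibrium_GAS:
  "GAS_on (rad_field aL aR mL mR gRL gLR) (rad_simplex - {(0, 0)}) (l, r)"
  unfolding GAS_on_def
proof (intro conjI allI impI)
  let ?f = "rad_field aL aR mL mR gRL gLR"
  define c1 where "c1 = min mL mR / (aL + aR + gRL + gLR + min mL mR)"
  define c0 where "c0 = min c c1 / 2"
  have "0 < c1" unfolding c1_def using pos by (intro divide_pos_pos add_pos_pos) auto
  then have c0: "0 < c0" "c0 < c" "c0 < c1"
    unfolding c0_def using c_pos by (auto simp: min_def)
  show "(l, r) \<in> rad_simplex - {(0, 0)}"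
    using l_pos r_pos sum_less by (simp add: rad_simplex_def)
  show "?f (l, r) = 0"
    using eq_L eq_R by (simp add: rad_field_def Let_def zero_prod_def)
  show "\<exists>\<delta>>0. \<forall>x. is_solution ?f x \<and> x 0 \<in> rad_simplex - {(0, 0)} \<and> dist (x 0) (l, r) < \<delta> \<longrightarrow>
      (\<forall>t\<ge>0. dist (x t) (l, r) < \<epsilon>)" if "0 < \<epsilon>" for \<epsilon>
  proof (cases "d = 0")
    case True
    obtain k V where "0 < k" "lyapunov c0 V (\<lambda>q. k * (snd q / r - 1)\<^sup>2)"
      using lyapunov_equal_exit_rates[OF True c0(1)] by (elim exE conjE) (rule that)
    show ?thesis by (rule stable_of_lyapunov_function[OF _ c0(2) that]) fact
  next
    case False
    obtain k V where "lyapunov c0 V (\<lambda>q. k * (logratio q)\<^sup>2)"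
      using lyapunov_unequal_exit_rates[OF False c0(1,2)] by (elim exE conjE) (rule that)
    show ?thesis by (rule stable_of_lyapunov_function[OF _ c0(2) that]) fact
  qed
  show "(x \<longlongrightarrow> (l, r)) at_top" if sol: "is_solution ?f x \<and> x 0 \<in> rad_simplex - {(0, 0)}" for x
  proof -
    obtain T where "persistent_trajectory aL aR mL mR gRL gLR l r (\<lambda>t. fst (x t)) (\<lambda>t. snd (x t)) T c0"
      using persistent_of_solution[of x c0] sol c0 unfolding c1_def by blast
    then interpret persistent_trajectory aL aR mL mR gRL gLR l r "\<lambda>t. fst (x t)" "\<lambda>t. snd (x t)" T c0 .
    show ?thesis using converges_equal_exit_rates converges_unequal_exit_rates by (cases "d = 0") auto
  qed
qed

section \<open>The Perron root\<close>

lemma eigenvalue_two_by_two: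
  fixes a b c d x :: complex
  assumes "b \<noteq> 0"
  shows "eigenvalue (mat_of_rows_list 2 [[a, b], [c, d]]) x \<longleftrightarrow> (x - a) * (x - d) = b * c"
proof
  let ?A = "mat_of_rows_list 2 [[a, b], [c, d]]"
  have dim: "dim_row ?A = 2" by (simp add: mat_of_rows_list_def)
  have mult: "?A *\<^sub>v v = vec_of_list [a * v $ 0 + b * v $ 1, c * v $ 0 + d * v $ 1]"
    if "v \<in> carrier_vec 2" for v
    using that
    by (intro eq_vecI) (auto simp: mat_of_rows_list_def scalar_prod_def numeral_2_eq_2 less_Suc_eq)
  {
    assume "eigenvalue ?A x"
    then obtain v where v: "v \<in> carrier_vec 2" "v \<noteq> 0\<^sub>v 2" "?A *\<^sub>v v = x \<cdot>\<^sub>v v"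
      unfolding eigenvalue_def eigenvector_def dim by blast
    have "(?A *\<^sub>v v) $ 0 = (x \<cdot>\<^sub>v v) $ 0" "(?A *\<^sub>v v) $ 1 = (x \<cdot>\<^sub>v v) $ 1" using v(3) by simp_all
    then have eqs: "a * v $ 0 + b * v $ 1 = x * v $ 0" "c * v $ 0 + d * v $ 1 = x * v $ 1"
      using v(1) unfolding mult[OF v(1)] by auto
    have "v $ 0 \<noteq> 0"
    proof
      assume "v $ 0 = 0"
      then have "v $ 1 = 0" using eqs(1) assms by simp
      then have "v = 0\<^sub>v 2" using v(1) \<open>v $ 0 = 0\<close> by (intro eq_vecI) (auto simp: less_2_cases_iff)
      then show False using v(2) by simp
    qed
    have "v $ 0 * ((x - a) * (x - d)) = (x * v $ 0 - a * v $ 0) * (x - d)" by (simp add: algebra_simps)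
    also have "x * v $ 0 - a * v $ 0 = b * v $ 1" using eqs(1) by (simp add: algebra_simps)
    also have "b * v $ 1 * (x - d) = b * (x * v $ 1 - d * v $ 1)" by (simp add: algebra_simps)
    also have "x * v $ 1 - d * v $ 1 = c * v $ 0" using eqs(2) by (simp add: algebra_simps)
    also have "b * (c * v $ 0) = v $ 0 * (b * c)" by simp
    finally show "(x - a) * (x - d) = b * c" using \<open>v $ 0 \<noteq> 0\<close> mult_left_cancel by blast
  }
  assume root: "(x - a) * (x - d) = b * c"
  define v where "v = vec 2 (\<lambda>i. if i = 0 then b else x - a)"
  have v: "v \<in> carrier_vec 2" "v $ 0 = b" "v $ 1 = x - a"
    unfolding v_def by simp_all
  have row: "c * b + d * (x - a) = x * (x - a)" using root by (simp add: algebra_simps)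
  have "?A *\<^sub>v v = x \<cdot>\<^sub>v v"
  proof (rule eq_vecI)
    fix i assume "i < dim_vec (x \<cdot>\<^sub>v v)"
    then have "i = 0 \<or> i = 1" using v(1) by auto
    then show "(?A *\<^sub>v v) $ i = (x \<cdot>\<^sub>v v) $ i"
    proof
      assume "i = 0"
      then show ?thesis unfolding mult[OF v(1)] using v(1) by (simp add: v(2,3)[simplified] algebra_simps)
    next
      assume "i = 1"
      then show ?thesis unfolding mult[OF v(1)] using v(1) row by (simp add: v(2,3)[simplified])
    qed
  qed (use v(1) mult[OF v(1)] in simp)
  moreover have "v \<noteq> 0\<^sub>v 2" using v(2) assms by auto
  ultimately show "eigenvalue ?A x"
    unfolding eigenvalue_def eigenvector_def dim using v(1) by blast
qed

definition positive_root :: "real \<Rightarrow> real \<Rightarrow> real \<Rightarrow> real \<Rightarrow> real" where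
  "positive_root a b c d = (a + d + sqrt ((a - d)\<^sup>2 + 4 * b * c)) / 2"

lemma positive_root_props:
  fixes a b c d :: real
  assumes "0 < a" "0 < b" "0 < c" "0 < d"
  defines "x \<equiv> positive_root a b c d"
  shows "(x - a) * (x - d) = b * c" "a < x" "d < x"
proof -
  define s where "s = sqrt ((a - d)\<^sup>2 + 4 * b * c)"
  have bc: "0 < b * c" using assms by simp
  have s2: "s\<^sup>2 = (a - d)\<^sup>2 + 4 * b * c" unfolding s_def using bc by (simp add: add_nonneg_nonneg)
  have "\<bar>a - d\<bar> < s" unfolding s_def by (rule real_less_rsqrt) (use bc in simp)
  then show "a < x" "d < x" unfolding x_def positive_root_def s_def[symmetric] by (auto simp: abs_less_iff)
  have "4 * ((x - a) * (x - d)) = s\<^sup>2 - (a - d)\<^sup>2"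
    unfolding x_def positive_root_def s_def[symmetric] by (simp add: field_simps power2_eq_square)
  then show "(x - a) * (x - d) = b * c" unfolding s2 by simp
qed

lemma spectral_radius_two_by_two:
  fixes a b c d :: real
  assumes "0 < a" "0 < b" "0 < c" "0 < d"
  shows "spectral_radius (map_mat complex_of_real (mat_of_rows_list 2 [[a, b], [c, d]])) = positive_root a b c d"
proof -
  define x where "x = positive_root a b c d"
  note x = positive_root_props[OF assms, folded x_def]
  let ?A = "mat_of_rows_list 2 [[complex_of_real a, complex_of_real b], [complex_of_real c, complex_of_real d]]"
  have A: "map_mat complex_of_real (mat_of_rows_list 2 [[a, b], [c, d]]) = ?A"
    by (intro eq_matI) (auto simp: mat_of_rows_list_def less_Suc_eq numeral_2_eq_2)
  have root: "y \<in> spectrum ?A \<longleftrightarrow> (y - of_real a) * (y - of_real d) = of_real b * of_real c" for y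
    unfolding spectrum_def using eigenvalue_two_by_two assms by simp
  have "(of_real x - of_real a) * (of_real x - of_real d) = (of_real b * of_real c :: complex)"
    using x(1) by (metis of_real_diff of_real_mult)
  then have mem: "of_real x \<in> spectrum ?A" using root by simp
  have le: "norm y \<le> x" if "y \<in> spectrum ?A" for y
  proof -
    have eq: "(y - of_real a) * (y - of_real d) = of_real ((x - a) * (x - d))"
      using that root x(1) by simp
    have "(y - of_real x) * (y - of_real (a + d - x)) = 0"
      using eq by (simp add: algebra_simps)
    then have "y = of_real x \<or> y = of_real (a + d - x)" by simp
    then have "norm y = \<bar>x\<bar> \<or> norm y = \<bar>a + d - x\<bar>" by (metis norm_of_real)
    then show ?thesis using x(2,3) assms by auto
  qed
  have carrier: "?A \<in> carrier_mat 2 2" by (auto simp: mat_of_rows_list_def)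
  have "spectral_radius ?A \<le> x"
    using spectral_radius_mem_max(1)[OF carrier] le by auto
  moreover have "norm (complex_of_real x) \<le> spectral_radius ?A"
    by (rule spectral_radius_mem_max(2)[OF carrier _ imageI[OF mem]]) simp
  ultimately show ?thesis unfolding A x_def[symmetric] using x(2) assms by simp
qed

lemma perron_root_eq:
  assumes "0 < aL" "0 < aR" "0 < mL" "0 < mR" "0 < gRL" "0 < gLR"
  shows "perron_root aL aR mL mR gRL gLR = positive_root (aL / mL) (gRL / mL) (gLR / mR) (aR / mR)"
proof -
  have "M_inv_mat mL mR * K_mat aL aR gRL gLR = mat_of_rows_list 2 [[aL / mL, gRL / mL], [gLR / mR, aR / mR]]"
    unfolding M_inv_mat_def K_mat_def
    by (intro eq_matI) (auto simp: mat_of_rows_list_def scalar_prod_def less_2_cases_iff numeral_2_eq_2 less_Suc_eq)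
  then show ?thesis
    unfolding perron_root_def using spectral_radius_two_by_two assms by simp
qed

lemma interior_equilibrium_unique:
  assumes "GAS_on f (rad_simplex - {(0, 0)}) E" "interior_equilibrium f E'"
  shows "E' = E"
proof -
  have "is_solution f (\<lambda>_. E')"
    using assms(2) unfolding is_solution_def interior_equilibrium_def by simp
  moreover have "E' \<in> rad_simplex - {(0, 0)}"
    using assms(2) unfolding interior_equilibrium_def rad_simplex_def by (cases E') auto
  ultimately have "((\<lambda>_::real. E') \<longlongrightarrow> E) at_top"
    using assms(1) unfolding GAS_on_def by blast
  then show ?thesis by (simp add: tendsto_const_iff)
qed

theorem theorem3p12:
  fixes aL aR muL muR gRL gLR :: real
  assumes "aL > 0" "aR > 0" "muL > 0" "muR > 0" "gRL > 0" "gLR > 0"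
  defines "f \<equiv> rad_field aL aR muL muR gRL gLR"
    and "lam \<equiv> perron_root aL aR muL muR gRL gLR"
  shows "(lam \<le> 1 \<longrightarrow> GAS_on f rad_simplex (0, 0)) \<and>
         (lam > 1 \<longrightarrow> (\<exists>E. interior_equilibrium f E \<and>
                              (\<forall>E'. interior_equilibrium f E' \<longrightarrow> E' = E) \<and>
                              GAS_on f (rad_simplex - {(0, 0)}) E))"
proof (intro conjI impI)
  have sys: "radical_system aL aR muL muR gRL gLR" using assms(1-6) by unfold_locales
  define a b c d where "a = aL / muL" and "b = gRL / muL" and "c = gLR / muR" and "d = aR / muR"
  have abcd: "0 < a" "0 < b" "0 < c" "0 < d" unfolding a_def b_def c_def d_def using assms(1-6) by auto
  have lam: "lam = positive_root a b c d"
    unfolding lam_def a_def b_def c_def d_def using assms(1-6) by (intro perron_root_eq)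
  have root: "(lam - a) * (lam - d) = b * c" and lam_gt: "a < lam" "d < lam"
    using positive_root_props[OF abcd] unfolding lam by auto
  have rates: "aL = a * muL" "gRL = b * muL" "gLR = c * muR" "aR = d * muR"
    unfolding a_def b_def c_def d_def using assms(3,4) by auto
  {
    assume "lam \<le> 1"
    have "subcritical_axioms aL aR muL muR gRL gLR c (lam - a) lam"
    proof
      have "c * aL / muL + (lam - a) * gLR / muR = c * a + (lam - a) * c"
        unfolding rates using assms(3,4) by simp
      then show "c * aL / muL + (lam - a) * gLR / muR = lam * c" by (simp add: algebra_simps)
      have "c * gRL / muL + (lam - a) * aR / muR = b * c + (lam - a) * d"
        unfolding rates using assms(3,4) by simp
      then show "c * gRL / muL + (lam - a) * aR / muR = lam * (lam - a)"
        unfolding root[symmetric] by (simp add: algebra_simps)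
    qed (use abcd lam_gt \<open>lam \<le> 1\<close> in auto)
    then interpret subcritical aL aR muL muR gRL gLR c "lam - a" lam
      using sys by (intro subcritical.intro)
    show "GAS_on f rad_simplex (0, 0)" unfolding f_def by (rule origin_GAS)
  }
  assume "1 < lam"
  define k where "k = (1 - 1 / lam) / (b + (lam - a))"
  have k: "0 < k" "k * (b + (lam - a)) = 1 - 1 / lam"
    unfolding k_def using \<open>1 < lam\<close> abcd lam_gt by auto
  define l where "l = k * b"
  define r where "r = k * (lam - a)"
  have total: "1 - l - r = 1 / lam" using k(2) unfolding l_def r_def by (simp add: algebra_simps)
  have "supercritical_axioms aL aR muL muR gRL gLR l r"
  proof
    show "0 < l" "0 < r" unfolding l_def r_def using k(1) abcd lam_gt by auto
    show "l + r < 1" using total \<open>1 < lam\<close> by (smt (verit) divide_pos_pos)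
    have "aL * l * (1 / lam) - muL * l + gRL * r * (1 / lam) = 0"
      unfolding rates l_def r_def using \<open>1 < lam\<close> by (simp add: field_simps)
    then show "aL * l * (1 - l - r) - muL * l + gRL * r * (1 - l - r) = 0"
      unfolding total .
    have "aR * r * (1 / lam) - muR * r + gLR * l * (1 / lam)
        = k * muR / lam * (d * (lam - a) - lam * (lam - a) + c * b)"
      unfolding rates l_def r_def using \<open>1 < lam\<close> by (simp add: field_simps)
    also have "d * (lam - a) - lam * (lam - a) + c * b = 0" using root by (simp add: algebra_simps)
    finally show "aR * r * (1 - l - r) - muR * r + gLR * l * (1 - l - r) = 0"
      unfolding total by simp
  qed
  then interpret supercritical aL aR muL muR gRL gLR l r
    using sys by (intro supercritical.intro)
  have gas: "GAS_on f (rad_simplex - {(0, 0)}) (l, r)" unfolding f_def by (rule equilibrium_GAS)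
  then have "interior_equilibrium f (l, r)"
    using l_pos r_pos sum_less unfolding interior_equilibrium_def GAS_on_def by simp
  then show "\<exists>E. interior_equilibrium f E \<and> (\<forall>E'. interior_equilibrium f E' \<longrightarrow> E' = E) \<and>
      GAS_on f (rad_simplex - {(0, 0)}) E"
    using gas interior_equilibrium_unique by blast
qed

end
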